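(* Every evil-avoiding permutation $\pi$ can be written uniquely as $\pi=\psi_{x_m}\circ\cdots\circ\psi_{x_1}(e_0)$ with $m\ge0$ and $x_1,\dots,x_m\in\{p,q,r,s\}$, where each operator $\psi_{x_j}$ is applied to a permutation in its domain.
   Context: Permutations $\pi\in S_n$ are written in one-line form; $e_n$ is the identity of $S_n$ and $e_0$ the empty permutation. A permutation is evil-avoiding if it avoids $2413,4132,4213,3214$. A recoil of $\pi\in S_n$ is $i\in\{1,\dots,n-1\}$ with $\pi^{-1}_i>\pi^{-1}_{i+1}$. For $\pi\in S_n$ and $1\le i,j\le n+1$, $\rho_{i,j}(\pi)\in S_{n+1}$ is obtained by increasing by $1$ every entry $\ge i$ and inserting value $i$ at position $j$; for $a>b$, $\gamma_{a,b}(\pi)$ removes the entry at position $a$ and reinserts it at position $b$. For $a\ge0$, $b\ge1$, $\pi\in S_n$ is $(a,b)$-sandwiched if $(\pi_1,\dots,\pi_a)=(1,\dots,a)$ and $(\pi_{n-b+1},\dots,\pi_n)=(a+1,\dots,a+b)$. Operators: $\psi_p=\rho_{1,1}$, domain non-identity evil-avoiding permutations; $\psi_q$, domain non-identity evil-avoiding permutations, with $\psi_q(\pi)=\gamma_{n-b+2,a+2}(\rho_{t+1,1}(\pi))$ if $\pi\in S_n$ is $(a,b)$-sandwiched and $\psi_q(\pi)=\rho_{t+1,1}(\pi)$ otherwise, where $t$ is the smallest recoil of $\pi$; $\psi_r(\pi)=\rho_{1,n+1}(\pi)$, domain evil-avoiding $\pi\in S_n$, $n\ge1$; $\psi_s(\pi)=\rho_{\pi_n+1,n+1}(\pi)$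 for $n\ge1$ and $\psi_s(e_0)=[1]$, with domain the evil-avoiding $\pi\in S_n$ ($n\ge0$) that are either $e_n$ or satisfy $(\pi_{n-t+1},\dots,\pi_n)=(1,\dots,t)$ for some $t\ge1$. *)

theory Defs
  imports Main
begin

text \<open>Permutations of S_n in one-line form are lists of length n whose entries are
  exactly 1..n. Positions and values are 1-based, as in the paper.\<close>

definition is_perm :: "nat list \<Rightarrow> bool" where
  "is_perm \<pi> \<longleftrightarrow> distinct \<pi> \<and> set \<pi> = {1..length \<pi>}"

definition ident :: "nat \<Rightarrow> nat list" where
  "ident n = [1..<n+1]"

definition contains :: "nat list \<Rightarrow> nat list \<Rightarrow> bool" where
  "contains \<pi> \<sigma> \<longleftrightarrow> (\<exists>is. length is = length \<sigma> \<and> sorted_wrt (<) is \<and>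
      (\<forall>j\<in>set is. j < length \<pi>) \<and>
      (\<forall>a<length \<sigma>. \<forall>b<length \<sigma>. (\<pi> ! (is ! a) < \<pi> ! (is ! b)) \<longleftrightarrow> (\<sigma> ! a < \<sigma> ! b)))"

definition avoids :: "nat list \<Rightarrow> nat list \<Rightarrow> bool" where
  "avoids \<pi> \<sigma> \<longleftrightarrow> \<not> contains \<pi> \<sigma>"

definition evil_avoiding :: "nat list \<Rightarrow> bool" where
  "evil_avoiding \<pi> \<longleftrightarrow> is_perm \<pi> \<and> avoids \<pi> [2,4,1,3] \<and> avoids \<pi> [4,1,3,2]
      \<and> avoids \<pi> [4,2,1,3] \<and> avoids \<pi> [3,2,1,4]"

definition is_recoil :: "nat list \<Rightarrow> nat \<Rightarrow> bool" where
  "is_recoil \<pi> i \<longleftrightarrow> 1 \<le> i \<and> i < length \<pi> \<and>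
     (\<exists>p q. p < q \<and> q < length \<pi> \<and> \<pi> ! p = i + 1 \<and> \<pi> ! q = i)"

definition min_recoil :: "nat list \<Rightarrow> nat" where
  "min_recoil \<pi> = (LEAST i. is_recoil \<pi> i)"

definition rho :: "nat \<Rightarrow> nat \<Rightarrow> nat list \<Rightarrow> nat list" where
  "rho i j \<pi> = (let \<pi>' = map (\<lambda>x. if x \<ge> i then x + 1 else x) \<pi>
                in take (j - 1) \<pi>' @ [i] @ drop (j - 1) \<pi>')"

definition gamma :: "nat \<Rightarrow> nat \<Rightarrow> nat list \<Rightarrow> nat list" where
  "gamma a b \<pi> = (let x = \<pi> ! (a - 1); \<sigma> = take (a - 1) \<pi> @ drop a \<pi>
                  in take (b - 1) \<sigma> @ [x] @ drop (b - 1) \<sigma>)"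

definition sandwiched :: "nat \<Rightarrow> nat \<Rightarrow> nat list \<Rightarrow> bool" where
  "sandwiched a b \<pi> \<longleftrightarrow> 1 \<le> b \<and> a + b \<le> length \<pi> \<and>
     take a \<pi> = [1..<a+1] \<and> drop (length \<pi> - b) \<pi> = [a+1..<a+b+1]"

datatype op = P | Q | R | S

fun dom_op :: "op \<Rightarrow> nat list \<Rightarrow> bool" where
  "dom_op P \<pi> = (evil_avoiding \<pi> \<and> \<pi> \<noteq> ident (length \<pi>))"
| "dom_op Q \<pi> = (evil_avoiding \<pi> \<and> \<pi> \<noteq> ident (length \<pi>))"
| "dom_op R \<pi> = (evil_avoiding \<pi> \<and> length \<pi> \<ge> 1)"
| "dom_op S \<pi> = (evil_avoiding \<pi> \<and> (\<pi> = ident (length \<pi>) \<or>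
      (\<exists>t. 1 \<le> t \<and> t \<le> length \<pi> \<and> drop (length \<pi> - t) \<pi> = [1..<t+1])))"

definition psi_q :: "nat list \<Rightarrow> nat list" where
  "psi_q \<pi> = (let n = length \<pi>; t = min_recoil \<pi> in
     if \<exists>a b. sandwiched a b \<pi> then
       (case SOME ab. sandwiched (fst ab) (snd ab) \<pi> of (a, b) \<Rightarrow>
          gamma (n - b + 2) (a + 2) (rho (t + 1) 1 \<pi>))
     else rho (t + 1) 1 \<pi>)"

fun psi :: "op \<Rightarrow> nat list \<Rightarrow> nat list" where
  "psi P \<pi> = rho 1 1 \<pi>"
| "psi Q \<pi> = psi_q \<pi>"
| "psi R \<pi> = rho 1 (length \<pi> + 1) \<pi>"
| "psi S \<pi> = (if \<pi> = [] then [1] else rho (last \<pi> + 1) (length \<pi> + 1) \<pi>)"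

fun run :: "op list \<Rightarrow> nat list \<Rightarrow> nat list option" where
  "run [] \<sigma> = Some \<sigma>"
| "run (x # xs) \<sigma> = (if dom_op x \<sigma> then run xs (psi x \<sigma>) else None)"

end

theory Submission
  imports Defs
begin

text \<open>
  The last operator can be read off an evil-avoiding \<open>\<tau>\<close>: it is \<open>S\<close> if \<open>\<tau>\<close> ends with \<open>1, \<dots>, k\<close> for
  some \<open>k \<ge> 2\<close> (or \<open>\<tau> = [1]\<close>), \<open>R\<close> if it ends with \<open>1\<close>, \<open>P\<close> if it starts with \<open>1\<close>, and \<open>Q\<close>
  otherwise. Given the operator, its argument is recovered by deleting an entry, except for \<open>Q\<close>.
  There, avoidance forces the values below the first entry \<open>h = t + 1\<close> to increase, so \<open>t\<close> is the
  smallest recoil. If \<open>t + 2\<close> precedes \<open>t\<close> and deleting \<open>h\<close> leaves no sandwiched permutation,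
  that deletion is the argument. In the remaining cases
  \<open>\<tau> = h, 1, \<dots>, a, s, a + 1, \<dots>, t\<close> with \<open>a \<ge> 1\<close> and all entries of \<open>s\<close> above \<open>h\<close>,
  and the argument is \<open>1, \<dots>, a - 1, s, a, \<dots>, t\<close> with \<open>s\<close> lowered by one.
\<close>

section \<open>Relative order of values and pattern avoidance\<close>

declare upt_Suc [simp del]

text \<open>On a distinct list this is a strict total order on the entries. It lets occurrences of
  patterns and recoils be discussed by values instead of positions.\<close>

fun before :: "'a list \<Rightarrow> 'a \<Rightarrow> 'a \<Rightarrow> bool" where
  "before [] a b = False"
| "before (x # xs) a b = (a = x \<and> b \<in> set xs \<or> before xs a b)"

lemma before_append:
  "before (xs @ ys) a b \<longleftrightarrow> before xs a b \<or> before ys a b \<or> a \<in> set xs \<and> b \<in> set ys"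
  by (induction xs) auto

lemma before_set: "before xs a b \<Longrightarrow> a \<in> set xs \<and> b \<in> set xs"
  by (induction xs) auto

lemma before_irrefl: "distinct xs \<Longrightarrow> before xs a b \<Longrightarrow> a \<noteq> b"
  by (induction xs) (auto dest: before_set)

lemma before_asym: "distinct xs \<Longrightarrow> before xs a b \<Longrightarrow> \<not> before xs b a"
  by (induction xs) (auto dest: before_set)

lemma before_trans: "distinct xs \<Longrightarrow> before xs a b \<Longrightarrow> before xs b c \<Longrightarrow> before xs a c"
  by (induction xs) (auto dest: before_set)

lemma before_total: "a \<in> set xs \<Longrightarrow> b \<in> set xs \<Longrightarrow> a \<noteq> b \<Longrightarrow> before xs a b \<or> before xs b a"
  by (induction xs) auto

lemma before_map_iff:
  "before (map f xs) a b \<longleftrightarrow> (\<exists>x y. before xs x y \<and> a = f x \<and> b = f y)"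
  by (induction xs) auto

lemma before_map_inj: "inj f \<Longrightarrow> before (map f xs) (f a) (f b) \<longleftrightarrow> before xs a b"
  by (auto simp: before_map_iff inj_eq)

lemma before_iff_nth:
  "before xs a b \<longleftrightarrow> (\<exists>i j. i < j \<and> j < length xs \<and> xs ! i = a \<and> xs ! j = b)"
proof (induction xs)
  case (Cons x xs)
  have "(\<exists>i j. i < j \<and> j < length (x # xs) \<and> (x # xs) ! i = a \<and> (x # xs) ! j = b) \<longleftrightarrow>
        (\<exists>j. j < length xs \<and> x = a \<and> xs ! j = b) \<or>
        (\<exists>i j. i < j \<and> j < length xs \<and> xs ! i = a \<and> xs ! j = b)" (is "?L \<longleftrightarrow> ?R")
  proof
    assume ?L
    then obtain i j where ij: "i < j" "j < length (x # xs)" "(x # xs) ! i = a" "(x # xs) ! j = b"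
      by blast
    then show ?R by (cases i; cases j) auto
  next
    assume ?R
    then show ?L
    proof
      assume "\<exists>j. j < length xs \<and> x = a \<and> xs ! j = b"
      then obtain j where "j < length xs" "x = a" "xs ! j = b" by blast
      then show ?L by (intro exI[of _ 0] exI[of _ "Suc j"]) auto
    next
      assume "\<exists>i j. i < j \<and> j < length xs \<and> xs ! i = a \<and> xs ! j = b"
      then obtain i j where "i < j" "j < length xs" "xs ! i = a" "xs ! j = b" by blast
      then show ?L by (intro exI[of _ "Suc i"] exI[of _ "Suc j"]) auto
    qed
  qed
  then show ?case using Cons by (auto simp: in_set_conv_nth)
qed simp

lemma sorted_wrt_iff_before: "sorted_wrt r xs \<longleftrightarrow> (\<forall>a b. before xs a b \<longrightarrow> r a b)"
  by (induction xs) auto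

lemma before_upt: "before [m..<n] a b \<longleftrightarrow> m \<le> a \<and> a < b \<and> b < n"
proof
  assume *: "before [m..<n] a b"
  have "sorted_wrt (<) [m..<n]" by simp
  then have "a < b" using * by (simp only: sorted_wrt_iff_before)
  then show "m \<le> a \<and> a < b \<and> b < n" using before_set[OF *] by auto
next
  assume *: "m \<le> a \<and> a < b \<and> b < n"
  then have "before [m..<n] a b \<or> before [m..<n] b a" by (intro before_total) auto
  moreover have "sorted_wrt (<) [m..<n]" by simp
  ultimately show "before [m..<n] a b" using * unfolding sorted_wrt_iff_before
    by fastforce
qed

lemma eq_upt_if_before:
  assumes "\<And>a b. before xs a b \<Longrightarrow> a < b" and "set xs = {m..<n}"
  shows "xs = [m..<n]"
proof -
  have "sorted_wrt (<) xs" using assms(1) by (simp add: sorted_wrt_iff_before)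
  then show ?thesis using assms(2) by (intro strict_sorted_equal) auto
qed

text \<open>Here \<open>a\<close>, \<open>b\<close>, \<open>c\<close>, \<open>d\<close> are the four
  entries of a candidate occurrence from left to right. The conjuncts exclude, in this order, 2413,
  4132, 4213 and 3214.\<close>

definition evil_free :: "nat list \<Rightarrow> bool" where
  "evil_free xs \<longleftrightarrow> (\<forall>a b c d. before xs a b \<longrightarrow> before xs b c \<longrightarrow> before xs c d \<longrightarrow>
     \<not> (c < a \<and> a < d \<and> d < b) \<and> \<not> (b < d \<and> d < c \<and> c < a) \<and>
     \<not> (c < b \<and> b < d \<and> d < a) \<and> \<not> (c < b \<and> b < a \<and> a < d))"

lemma evil_freeD:
  assumes "evil_free xs" "before xs a b" "before xs b c" "before xs c d"
  shows "\<not> (c < a \<and> a < d \<and> d < b)" "\<not> (b < d \<and> d < c \<and> c < a)"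
    "\<not> (c < b \<and> b < d \<and> d < a)" "\<not> (c < b \<and> b < a \<and> a < d)"
  using assms unfolding evil_free_def by blast+

text \<open>In a distinct list each value has one position, so three consecutive
  \<open>before\<close> facts chain to a single increasing sequence of four indices.\<close>

lemma contains_4_iff:
  assumes "distinct \<pi>"
  shows "contains \<pi> [p, q, r, s] \<longleftrightarrow>
    (\<exists>a b c d. before \<pi> a b \<and> before \<pi> b c \<and> before \<pi> c d \<and>
      (\<forall>i<4. \<forall>j<4. [a, b, c, d] ! i < [a, b, c, d] ! j \<longleftrightarrow> [p, q, r, s] ! i < [p, q, r, s] ! j))"
    (is "?L \<longleftrightarrow> ?R")
proof
  have len: "length [p, q, r, s] = 4" by simp
  assume ?L
  then obtain xs where xs: "length xs = 4" "sorted_wrt (<) xs" "\<forall>j\<in>set xs. j < length \<pi>"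
    "\<forall>i<4. \<forall>j<4. \<pi> ! (xs ! i) < \<pi> ! (xs ! j) \<longleftrightarrow> [p, q, r, s] ! i < [p, q, r, s] ! j"
    unfolding contains_def len by blast
  from xs(1) obtain i j k l where eq: "xs = [i, j, k, l]"
    by (auto simp: numeral_eq_Suc length_Suc_conv)
  have "before \<pi> (\<pi> ! i) (\<pi> ! j)" "before \<pi> (\<pi> ! j) (\<pi> ! k)" "before \<pi> (\<pi> ! k) (\<pi> ! l)"
    using xs(2,3) unfolding eq before_iff_nth by auto
  moreover have "[\<pi> ! i, \<pi> ! j, \<pi> ! k, \<pi> ! l] ! m = \<pi> ! (xs ! m)" if "m < 4" for m
  proof -
    have "m = 0 \<or> m = 1 \<or> m = 2 \<or> m = 3" using that by linarith
    then show ?thesis by (auto simp: eq)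
  qed
  ultimately show ?R using xs(4)
    by (intro exI[of _ "\<pi> ! i"] exI[of _ "\<pi> ! j"] exI[of _ "\<pi> ! k"] exI[of _ "\<pi> ! l"]) auto
next
  assume ?R
  then obtain a b c d where *: "before \<pi> a b" "before \<pi> b c" "before \<pi> c d"
    "\<forall>i<4. \<forall>j<4. [a, b, c, d] ! i < [a, b, c, d] ! j \<longleftrightarrow> [p, q, r, s] ! i < [p, q, r, s] ! j"
    by blast
  obtain i j where ij: "i < j" "j < length \<pi>" "\<pi> ! i = a" "\<pi> ! j = b"
    using *(1) unfolding before_iff_nth by blast
  obtain j' k where jk: "j' < k" "k < length \<pi>" "\<pi> ! j' = b" "\<pi> ! k = c"
    using *(2) unfolding before_iff_nth by blast
  obtain k' l where kl: "k' < l" "l < length \<pi>" "\<pi> ! k' = c" "\<pi> ! l = d"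
    using *(3) unfolding before_iff_nth by blast
  have "j' = j" "k' = k" using ij jk kl assms nth_eq_iff_index_eq less_trans by metis+
  then have "sorted_wrt (<) [i, j, k, l]" "\<forall>x\<in>set [i, j, k, l]. x < length \<pi>"
    using ij jk kl by auto
  moreover have "[a, b, c, d] ! m = \<pi> ! ([i, j, k, l] ! m)" if "m < 4" for m
  proof -
    have "m = 0 \<or> m = 1 \<or> m = 2 \<or> m = 3" using that by linarith
    then show ?thesis using ij jk kl \<open>j' = j\<close> \<open>k' = k\<close> by auto
  qed
  ultimately show ?L unfolding contains_def using *(4)
    by (intro exI[of _ "[i, j, k, l]"]) auto
qed

lemma all_less_4: "(\<forall>i<(4::nat). p i) \<longleftrightarrow> p 0 \<and> p 1 \<and> p 2 \<and> p 3"
proof -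
  have "i < (4::nat) \<longleftrightarrow> i = 0 \<or> i = 1 \<or> i = 2 \<or> i = 3" for i by linarith
  then show ?thesis by auto
qed

lemma evil_avoiding_iff: "evil_avoiding \<pi> \<longleftrightarrow> is_perm \<pi> \<and> evil_free \<pi>"
proof (cases "is_perm \<pi>")
  case True
  then have d: "distinct \<pi>" by (simp add: is_perm_def)
  have c: "contains \<pi> [2,4,1,3] \<longleftrightarrow> (\<exists>a b c d. before \<pi> a b \<and> before \<pi> b c \<and> before \<pi> c d \<and>
        (c < a \<and> a < d \<and> d < b))"
    "contains \<pi> [4,1,3,2] \<longleftrightarrow> (\<exists>a b c d. before \<pi> a b \<and> before \<pi> b c \<and> before \<pi> c d \<and>
        (b < d \<and> d < c \<and> c < a))"
    "contains \<pi> [4,2,1,3] \<longleftrightarrow> (\<exists>a b c d. before \<pi> a b \<and> before \<pi> b c \<and> before \<pi> c d \<and>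
        (c < b \<and> b < d \<and> d < a))"
    "contains \<pi> [3,2,1,4] \<longleftrightarrow> (\<exists>a b c d. before \<pi> a b \<and> before \<pi> b c \<and> before \<pi> c d \<and>
        (c < b \<and> b < a \<and> a < d))"
    unfolding contains_4_iff[OF d] all_less_4
    by ((rule ex_cong1)+, (rule conj_cong[OF refl])+, (auto)[1])+
  show ?thesis
  proof
    assume "evil_avoiding \<pi>"
    then have "\<not> contains \<pi> [2,4,1,3]" "\<not> contains \<pi> [4,1,3,2]" "\<not> contains \<pi> [4,2,1,3]"
      "\<not> contains \<pi> [3,2,1,4]"
      by (auto simp: evil_avoiding_def avoids_def)
    note n = this[unfolded c]
    show "is_perm \<pi> \<and> evil_free \<pi>" unfolding evil_free_def
    proof (intro conjI allI impI True)
      fix a b c d assume *: "before \<pi> a b" "before \<pi> b c" "before \<pi> c d"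
      show "\<not> (c < a \<and> a < d \<and> d < b)" using n(1) * by blast
      show "\<not> (b < d \<and> d < c \<and> c < a)" using n(2) * by blast
      show "\<not> (c < b \<and> b < d \<and> d < a)" using n(3) * by blast
      show "\<not> (c < b \<and> b < a \<and> a < d)" using n(4) * by blast
    qed
  next
    assume "is_perm \<pi> \<and> evil_free \<pi>"
    then have e: "evil_free \<pi>" by simp
    have "\<not> contains \<pi> [2,4,1,3]" unfolding c using evil_freeD(1)[OF e] by metis
    moreover have "\<not> contains \<pi> [4,1,3,2]" unfolding c using evil_freeD(2)[OF e] by metis
    moreover have "\<not> contains \<pi> [4,2,1,3]" unfolding c using evil_freeD(3)[OF e] by metis
    moreover have "\<not> contains \<pi> [3,2,1,4]" unfolding c using evil_freeD(4)[OF e] by metis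
    ultimately show "evil_avoiding \<pi>" using True by (simp add: evil_avoiding_def avoids_def)
  qed
qed (simp add: evil_avoiding_def)

section \<open>Closure properties of evil-free lists\<close>

lemma evil_free_mono:
  assumes "evil_free ys" and "\<And>a b. before xs a b \<Longrightarrow> before ys a b"
  shows "evil_free xs"
  using assms unfolding evil_free_def by blast

lemma evil_free_map:
  assumes "strict_mono f"
  shows "evil_free (map f xs) \<longleftrightarrow> evil_free xs"
proof
  have inj: "inj f" using assms by (rule strict_mono_imp_inj_on)
  note less = strict_mono_less[OF assms]
  show "evil_free xs" if "evil_free (map f xs)"
    unfolding evil_free_def
  proof (intro allI impI)
    fix a b c d assume *: "before xs a b" "before xs b c" "before xs c d"
    show "\<not> (c < a \<and> a < d \<and> d < b) \<and> \<not> (b < d \<and> d < c \<and> c < a) \<and>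
     \<not> (c < b \<and> b < d \<and> d < a) \<and> \<not> (c < b \<and> b < a \<and> a < d)"
      using evil_freeD[OF that, of "f a" "f b" "f c" "f d"] *
      by (simp add: before_map_inj[OF inj] less)
  qed
  show "evil_free (map f xs)" if "evil_free xs"
    unfolding evil_free_def
  proof (intro allI impI)
    fix a b c d assume *: "before (map f xs) a b" "before (map f xs) b c" "before (map f xs) c d"
    then obtain x y z w where eq: "a = f x" "b = f y" "c = f z" "d = f w"
      by (auto simp: before_map_iff)
    show "\<not> (c < a \<and> a < d \<and> d < b) \<and> \<not> (b < d \<and> d < c \<and> c < a) \<and>
     \<not> (c < b \<and> b < d \<and> d < a) \<and> \<not> (c < b \<and> b < a \<and> a < d)"
      using evil_freeD[OF that, of x y z w] *
      by (simp add: before_map_inj[OF inj] less eq)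
  qed
qed

text \<open>An entry of \<open>xs\<close> is smaller than everything after it, whereas each of the
  four patterns has a smaller entry somewhere after its first one. So every occurrence starts, and
  hence lies, in \<open>ys\<close>.\<close>

lemma evil_free_prepend_smaller:
  assumes "evil_free ys" "sorted_wrt (<) xs" "distinct (xs @ ys)"
    "\<And>x y. x \<in> set xs \<Longrightarrow> y \<in> set ys \<Longrightarrow> x < y"
  shows "evil_free (xs @ ys)"
  unfolding evil_free_def
proof (intro allI impI)
  fix a b c d
  assume *: "before (xs @ ys) a b" "before (xs @ ys) b c" "before (xs @ ys) c d"
  have lt: "a < x" if "a \<in> set xs" "before (xs @ ys) a x" for x
    using that assms(2,3,4) before_set[of ys a x] unfolding sorted_wrt_iff_before
    by (auto simp: before_append)
  have "before (xs @ ys) a c" "before (xs @ ys) a d"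
    using * assms(3) before_trans by metis+
  show "\<not> (c < a \<and> a < d \<and> d < b) \<and> \<not> (b < d \<and> d < c \<and> c < a) \<and>
     \<not> (c < b \<and> b < d \<and> d < a) \<and> \<not> (c < b \<and> b < a \<and> a < d)"
  proof (cases "a \<in> set xs")
    case True
    then show ?thesis using lt \<open>before (xs @ ys) a c\<close> \<open>before (xs @ ys) a d\<close> *(1)
      by (meson less_asym)
  next
    case False
    have step: "u \<in> set ys \<and> before ys u v" if "u \<notin> set xs" "before (xs @ ys) u v" for u v
      using that before_set[of xs u v] before_set[of ys u v] by (auto simp: before_append)
    have nx: "v \<notin> set xs" if "before ys u v" for u v
      using that assms(3) before_set by fastforce
    have "before ys a b" using step False *(1) by blast
    moreover have "before ys b c" using step nx calculation *(2) by blast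
    moreover have "before ys c d" using step nx calculation *(3) by blast
    ultimately show ?thesis using assms(1) unfolding evil_free_def by blast
  qed
qed

text \<open>In each pattern the first or the second entry is smaller than the last one. If the last
  entry lies in \<open>ys\<close>, so does this smaller one, and hence the last three entries all
  lie in \<open>ys\<close> and increase. None of the patterns ends with three increasing entries, so
  every occurrence lies in \<open>xs\<close>.\<close>

lemma evil_free_append_smaller:
  assumes "evil_free xs" "sorted_wrt (<) ys" "distinct (xs @ ys)"
    "\<And>x y. x \<in> set xs \<Longrightarrow> y \<in> set ys \<Longrightarrow> y < x"
  shows "evil_free (xs @ ys)"
  unfolding evil_free_def
proof (intro allI impI)
  fix a b c d
  assume *: "before (xs @ ys) a b" "before (xs @ ys) b c" "before (xs @ ys) c d"
  have ab: "before xs a b" if "b \<in> set xs" "before (xs @ ys) a b" for a b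
    using that assms(3) before_set[of ys a b] by (auto simp: before_append)
  have up: "u < v" if "u \<in> set ys" "before (xs @ ys) u v" for u v
    using that assms(2,3) before_set[of xs u v] unfolding sorted_wrt_iff_before
    by (auto simp: before_append)
  have stay: "v \<in> set ys" if "u \<in> set ys" "before (xs @ ys) u v" for u v
    using that assms(3) before_set[of xs u v] before_set[of ys u v] by (auto simp: before_append)
  have small: "u \<in> set ys" if "u < v" "v \<in> set ys" "u \<in> set (xs @ ys)" for u v
    using that assms(4) by fastforce
  have mem: "a \<in> set (xs @ ys)" "b \<in> set (xs @ ys)" "c \<in> set (xs @ ys)" "d \<in> set (xs @ ys)"
    using * before_set by metis+
  show "\<not> (c < a \<and> a < d \<and> d < b) \<and> \<not> (b < d \<and> d < c \<and> c < a) \<and>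
     \<not> (c < b \<and> b < d \<and> d < a) \<and> \<not> (c < b \<and> b < a \<and> a < d)"
  proof (cases "d \<in> set ys")
    case True
    have "b < c \<and> c < d" if "b \<in> set ys" using up stay that *(2,3) by blast
    moreover have "b \<in> set ys" if "a < d" using small[OF that True mem(1)] stay *(1) by blast
    moreover have "b \<in> set ys" if "b < d" using small[OF that True mem(2)] .
    ultimately show ?thesis by (cases "b \<in> set ys") auto
  next
    case False
    then have "d \<in> set xs" using mem by auto
    then have "before xs c d" using ab *(3) by blast
    moreover from this have "before xs b c" using ab *(2) before_set by metis
    moreover from this have "before xs a b" using ab *(1) before_set by metis
    ultimately show ?thesis using assms(1) unfolding evil_free_def by blast
  qed
qed

section \<open>Insertion and deletion of an entry\<close>

text \<open>The renumbering inside \<open>rho\<close>: the order isomorphism from the naturals onto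
  the naturals other than \<open>h\<close>. It therefore preserves \<open>before\<close> and the
  avoidance of patterns.\<close>

definition shift :: "nat \<Rightarrow> nat \<Rightarrow> nat" where
  "shift h x = (if h \<le> x then x + 1 else x)"

lemma strict_mono_shift: "strict_mono (shift h)"
  by (auto simp: strict_mono_def shift_def)

lemma inj_shift: "inj (shift h)"
  by (rule strict_mono_imp_inj_on[OF strict_mono_shift])

lemma shift_neq: "shift h x \<noteq> h"
  by (simp add: shift_def)

lemma map_shift_eq_iff: "map (shift h) xs = map (shift h) ys \<longleftrightarrow> xs = ys"
  using inj_shift by (simp add: inj_map_eq_map)

lemma map_shift_above: "(\<And>x. x \<in> set xs \<Longrightarrow> h \<le> x) \<Longrightarrow> map (shift h) xs = map Suc xs"
  by (simp add: shift_def)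

lemma map_shift_below: "(\<And>x. x \<in> set xs \<Longrightarrow> x < h) \<Longrightarrow> map (shift h) xs = xs"
  by (rule map_idI) (force simp: shift_def)

lemma ex_map_shift:
  assumes "h \<notin> set xs"
  shows "\<exists>ys. xs = map (shift h) ys"
proof
  show "xs = map (shift h) (map (\<lambda>x. if h < x then x - 1 else x) xs)"
    using assms by (auto simp: shift_def intro!: map_idI[symmetric])
qed

lemma shift_image:
  assumes "1 \<le> h" "h \<le> n + 1"
  shows "shift h ` {1..n} = {1..n + 1} - {h}"
proof
  show "shift h ` {1..n} \<subseteq> {1..n + 1} - {h}" using assms by (auto simp: shift_def)
  show "{1..n + 1} - {h} \<subseteq> shift h ` {1..n}"
  proof
    fix x assume x: "x \<in> {1..n + 1} - {h}"
    have "x = shift h (if h < x then x - 1 else x)" using x by (auto simp: shift_def)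
    moreover have "(if h < x then x - 1 else x) \<in> {1..n}" using x assms by auto
    ultimately show "x \<in> shift h ` {1..n}" by blast
  qed
qed

text \<open>\<open>shift h\<close> is injective and maps {1..n} onto {1..n+1} without
  \<open>h\<close>. The equivalence serves insertion by the operators as well as deletion in the
  search for preimages.\<close>

lemma is_perm_insert:
  assumes "1 \<le> h" "h \<le> length us + length vs + 1"
  shows "is_perm (map (shift h) us @ h # map (shift h) vs) \<longleftrightarrow> is_perm (us @ vs)"
proof -
  let ?n = "length us + length vs"
  let ?A = "shift h ` set (us @ vs)"
  have h: "h \<notin> ?A" using shift_neq[of h] by (metis imageE)
  have "distinct (map (shift h) us @ h # map (shift h) vs) \<longleftrightarrow>
      distinct (map (shift h) (us @ vs)) \<and> h \<notin> ?A"
    by auto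
  then have d: "distinct (map (shift h) us @ h # map (shift h) vs) \<longleftrightarrow> distinct (us @ vs)"
    using h inj_on_subset[OF inj_shift] by (simp only: distinct_map) auto
  have "set (map (shift h) us @ h # map (shift h) vs) = insert h ?A" by auto
  moreover have "insert h ?A = {1..?n + 1} \<longleftrightarrow> ?A = {1..?n + 1} - {h}"
  proof -
    have "insert h A = B \<longleftrightarrow> A = B - {h}" if "h \<notin> A" "h \<in> B" for A B using that by blast
    then show ?thesis using h assms by simp
  qed
  moreover have "\<dots> \<longleftrightarrow> ?A = shift h ` {1..?n}"
    using shift_image[OF assms] by simp
  moreover have "\<dots> \<longleftrightarrow> set (us @ vs) = {1..?n}"
    by (rule inj_image_eq_iff[OF inj_shift])
  ultimately show ?thesis unfolding is_perm_def d by simp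
qed

text \<open>Pattern classes are closed under deleting an entry and renumbering. This supplies the
  candidate preimages under all four operators.\<close>

lemma evil_avoiding_delete:
  assumes "evil_avoiding (us @ h # vs)"
  obtains us' vs' where "us = map (shift h) us'" "vs = map (shift h) vs'" "evil_avoiding (us' @ vs')"
proof -
  have p: "is_perm (us @ h # vs)" and e: "evil_free (us @ h # vs)"
    using assms by (auto simp: evil_avoiding_iff)
  have "h \<notin> set us" "h \<notin> set vs" using p by (auto simp: is_perm_def)
  then obtain us' vs' where eq: "us = map (shift h) us'" "vs = map (shift h) vs'"
    using ex_map_shift by metis
  have "h \<in> {1..length (us @ h # vs)}" using p unfolding is_perm_def by (metis in_set_conv_decomp)
  then have "is_perm (us' @ vs')" using p is_perm_insert[of h us' vs'] unfolding eq by simp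
  moreover have "evil_free (map (shift h) (us' @ vs'))"
    using e by (rule evil_free_mono) (auto simp: before_append eq)
  then have "evil_free (us' @ vs')" by (simp only: evil_free_map[OF strict_mono_shift])
  ultimately show ?thesis using that eq evil_avoiding_iff by blast
qed

lemma rho_front: "rho h 1 \<sigma> = h # map (shift h) \<sigma>"
  by (simp add: rho_def shift_def)

lemma rho_back: "rho h (length \<sigma> + 1) \<sigma> = map (shift h) \<sigma> @ [h]"
  by (simp add: rho_def shift_def)

lemma is_perm_pos: "is_perm \<sigma> \<Longrightarrow> x \<in> set \<sigma> \<Longrightarrow> 1 \<le> x"
  by (simp add: is_perm_def)

section \<open>Recoils and sandwiched permutations\<close>

lemma is_recoil_iff: "is_recoil \<pi> i \<longleftrightarrow> 1 \<le> i \<and> i < length \<pi> \<and> before \<pi> (i + 1) i"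
  by (auto simp: is_recoil_def before_iff_nth)

text \<open>If no value below \<open>m\<close> is a recoil, each of them precedes its successor, and
  these facts chain by transitivity.\<close>

lemma before_if_no_recoil:
  assumes "is_perm \<sigma>" "m \<le> length \<sigma>" "\<And>i. i < m \<Longrightarrow> \<not> is_recoil \<sigma> i" "1 \<le> i" "i < j" "j \<le> m"
  shows "before \<sigma> i j"
  using assms(5,6)
proof (induction j)
  case (Suc j)
  have "j \<in> set \<sigma>" "Suc j \<in> set \<sigma>" using assms Suc.prems by (auto simp: is_perm_def)
  then have *: "before \<sigma> j (Suc j)"
    using assms(2) assms(3)[of j] assms(4) Suc.prems before_total[of j \<sigma> "Suc j"]
    by (auto simp: is_recoil_iff)
  show ?case
  proof (cases "i = j")
    case False
    then have "before \<sigma> i j" using Suc by simp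
    then show ?thesis using * assms(1) before_trans[of \<sigma> i j "Suc j"] by (simp add: is_perm_def)
  qed (use * in simp)
qed simp

text \<open>A permutation without recoils has its values in increasing order and is the identity.
  Hence the \<open>LEAST\<close> in \<open>min_recoil\<close> ranges over a nonempty set here, and
  minimality puts the values up to it in increasing order.\<close>

lemma min_recoil_props:
  assumes "is_perm \<sigma>" "\<sigma> \<noteq> ident (length \<sigma>)"
  shows "1 \<le> min_recoil \<sigma>" "min_recoil \<sigma> < length \<sigma>" "before \<sigma> (min_recoil \<sigma> + 1) (min_recoil \<sigma>)"
    "\<And>i j. 1 \<le> i \<Longrightarrow> i < j \<Longrightarrow> j \<le> min_recoil \<sigma> \<Longrightarrow> before \<sigma> i j"
proof -
  have d: "distinct \<sigma>" and st: "set \<sigma> = {1..length \<sigma>}" using assms(1) by (auto simp: is_perm_def)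
  have "\<exists>i. is_recoil \<sigma> i"
  proof (rule ccontr)
    assume "\<nexists>i. is_recoil \<sigma> i"
    then have b: "before \<sigma> i j" if "1 \<le> i" "i < j" "j \<le> length \<sigma>" for i j
      using that before_if_no_recoil[OF assms(1) order_refl] by blast
    have "\<sigma> = [1..<length \<sigma> + 1]"
    proof (rule eq_upt_if_before)
      fix a b' assume *: "before \<sigma> a b'"
      have ne: "a \<noteq> b'" and nb: "\<not> before \<sigma> b' a"
        using before_irrefl[OF d *] before_asym[OF d *] .
      have "1 \<le> b'" "a \<le> length \<sigma>" using before_set[OF *] st by auto
      show "a < b'"
      proof (rule ccontr)
        assume "\<not> a < b'"
        then have "b' < a" using ne by linarith
        then show False using b nb \<open>1 \<le> b'\<close> \<open>a \<le> length \<sigma>\<close> by blast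
      qed
    next
      show "set \<sigma> = {1..<length \<sigma> + 1}" unfolding st by auto
    qed
    then show False using assms(2) by (simp add: ident_def)
  qed
  then have r: "is_recoil \<sigma> (min_recoil \<sigma>)" unfolding min_recoil_def by (metis LeastI)
  then show "1 \<le> min_recoil \<sigma>" "min_recoil \<sigma> < length \<sigma>" "before \<sigma> (min_recoil \<sigma> + 1) (min_recoil \<sigma>)"
    by (auto simp: is_recoil_iff)
  show "before \<sigma> i j" if "1 \<le> i" "i < j" "j \<le> min_recoil \<sigma>" for i j
  proof (rule before_if_no_recoil[OF assms(1) _ _ that])
    show "min_recoil \<sigma> \<le> length \<sigma>" using r by (simp add: is_recoil_iff)
    show "\<not> is_recoil \<sigma> k" if "k < min_recoil \<sigma>" for k
      using that not_less_Least unfolding min_recoil_def by blast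
  qed
qed

lemma min_recoil_eqI:
  assumes "distinct \<sigma>" "1 \<le> t" "t < length \<sigma>" "before \<sigma> (t + 1) t"
    "\<And>i. 1 \<le> i \<Longrightarrow> i < t \<Longrightarrow> before \<sigma> i (i + 1)"
  shows "min_recoil \<sigma> = t"
  unfolding min_recoil_def
proof (rule Least_equality)
  show "is_recoil \<sigma> t" using assms by (simp add: is_recoil_iff)
  show "t \<le> i" if "is_recoil \<sigma> i" for i
    using that assms(5)[of i] before_asym[OF assms(1)] unfolding is_recoil_iff by (meson not_le)
qed

section \<open>Final runs 1, ..., k and the operator \<open>S\<close>\<close>

definition ends :: "nat \<Rightarrow> nat list \<Rightarrow> bool" where
  "ends k \<tau> \<longleftrightarrow> (\<exists>us. \<tau> = us @ [1..<k + 1])"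

lemma ends_iff_drop: "ends k \<tau> \<longleftrightarrow> k \<le> length \<tau> \<and> drop (length \<tau> - k) \<tau> = [1..<k + 1]"
proof
  assume "ends k \<tau>"
  then show "k \<le> length \<tau> \<and> drop (length \<tau> - k) \<tau> = [1..<k + 1]" by (auto simp: ends_def)
next
  assume "k \<le> length \<tau> \<and> drop (length \<tau> - k) \<tau> = [1..<k + 1]"
  then show "ends k \<tau>" unfolding ends_def by (metis append_take_drop_id)
qed

text \<open>A nonempty identity ends with the run consisting of all its entries, so the identity
  clause contributes only the empty permutation. The bound on \<open>k\<close> matters because
  \<open>ends 0\<close> holds for every list.\<close>

lemma dom_op_S_iff: "dom_op S \<sigma> \<longleftrightarrow> evil_avoiding \<sigma> \<and> (\<sigma> = [] \<or> (\<exists>k\<ge>1. ends k \<sigma>))"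
proof -
  have "ends (length \<sigma>) \<sigma>" if "\<sigma> = ident (length \<sigma>)"
    using that by (simp add: ends_iff_drop ident_def)
  moreover have "\<sigma> = [] \<or> 1 \<le> length \<sigma>" by (cases \<sigma>) auto
  ultimately show ?thesis
    by (auto simp: ends_iff_drop ident_def)
qed

text \<open>The last entry is \<open>k\<close>, so \<open>k + 1\<close> is inserted at the end, and
  the entries of \<open>us\<close>, all larger than \<open>k\<close>, go up by one. The first form
  shows the longer final run, the second one fits the lemmas on insertion and deletion.\<close>

lemma psi_S_ends:
  assumes "is_perm (us @ [1..<k + 1])" "1 \<le> k"
  shows "psi S (us @ [1..<k + 1]) = map Suc us @ [1..<k + 2]"
    "psi S (us @ [1..<k + 1]) = map (shift (k + 1)) (us @ [1..<k + 1]) @ [k + 1]"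
    "\<And>x. x \<in> set us \<Longrightarrow> k < x"
proof -
  show *: "k < x" if "x \<in> set us" for x
  proof -
    have "x \<notin> {1..<k + 1}" using assms(1) that by (auto simp: is_perm_def disjoint_iff)
    then show ?thesis using that is_perm_pos[OF assms(1), of x] by auto
  qed
  have l: "last (us @ [1..<k + 1]) = k" using assms(2) by simp
  have m: "map (shift (k + 1)) us = map Suc us" "map (shift (k + 1)) [1..<k + 1] = [1..<k + 1]"
    using * by (intro map_shift_above map_shift_below; force)+
  show e: "psi S (us @ [1..<k + 1]) = map (shift (k + 1)) (us @ [1..<k + 1]) @ [k + 1]"
    using assms(2) unfolding rho_back[symmetric] psi.simps l by simp
  note e
  also have "\<dots> = map Suc us @ [1..<k + 1] @ [k + 1]" unfolding map_append m by simp
  also have "\<dots> = map Suc us @ [1..<k + 2]" using upt_Suc_append[of 1 "k + 1"] by simp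
  finally show "psi S (us @ [1..<k + 1]) = map Suc us @ [1..<k + 2]" .
qed

section \<open>Sandwiched permutations and the value of \<open>psi_q\<close>\<close>

lemma sandwiched_iff:
  "sandwiched a b \<sigma> \<longleftrightarrow> 1 \<le> b \<and> (\<exists>s. \<sigma> = [1..<a + 1] @ s @ [a + 1..<a + b + 1])"
proof
  assume *: "sandwiched a b \<sigma>"
  let ?s = "take (length \<sigma> - b - a) (drop a \<sigma>)"
  have "\<sigma> = take a \<sigma> @ ?s @ drop (length \<sigma> - b - a) (drop a \<sigma>)"
    by (simp only: append_take_drop_id)
  \<comment> \<open>The bound on \<open>a + b\<close> in \<open>sandwiched\<close> keeps the prefix
    and the suffix from overlapping, so a middle block \<open>?s\<close> fits between them.\<close>
  also have "drop (length \<sigma> - b - a) (drop a \<sigma>) = drop (length \<sigma> - b) \<sigma>"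
    using * by (simp add: sandwiched_def)
  finally show "1 \<le> b \<and> (\<exists>s. \<sigma> = [1..<a + 1] @ s @ [a + 1..<a + b + 1])"
    using * unfolding sandwiched_def by metis
next
  assume *: "1 \<le> b \<and> (\<exists>s. \<sigma> = [1..<a + 1] @ s @ [a + 1..<a + b + 1])"
  then obtain s where eq: "\<sigma> = [1..<a + 1] @ s @ [a + 1..<a + b + 1]" by blast
  have l: "length \<sigma> = a + length s + b" by (simp add: eq)
  have "take a \<sigma> = [1..<a + 1]" by (simp add: eq)
  moreover have "drop (length \<sigma> - b) \<sigma> = [a + 1..<a + b + 1]"
    unfolding l by (simp add: eq)
  ultimately show "sandwiched a b \<sigma>" using * l by (simp add: sandwiched_def)
qed

lemma sandwich_gt:
  assumes "is_perm ([1..<a + 1] @ s @ [a + 1..<a + b + 1])" "x \<in> set s"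
  shows "a + b < x"
proof -
  have "x \<notin> {1..<a + 1}" "x \<notin> {a + 1..<a + b + 1}"
    using assms unfolding is_perm_def by (auto simp: disjoint_iff)
  moreover have "1 \<le> x" using is_perm_pos assms by auto
  ultimately show ?thesis by auto
qed

text \<open>The first index \<open>k\<close> whose entry differs from \<open>k + 1\<close> is
  \<open>a\<close> by the left-hand list and \<open>c\<close> by the right-hand one.\<close>

lemma upt_prefix_eqD:
  assumes "[1..<a + 1] @ x # xs = [1..<c + 1] @ y # ys" "a + 1 < x" "c + 1 < y"
  shows "a = c"
proof (rule ccontr)
  assume "a \<noteq> c"
  have nth: "([1..<m + 1] @ z # zs) ! k = (if k = m then z else k + 1)" if "k \<le> m" for m k z and zs :: "nat list"
    using that by (auto simp: nth_append)
  show False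
  proof (cases "a < c")
    case True
    then show False using arg_cong[OF assms(1), of "\<lambda>l. l ! a"] assms(2) by (simp only: nth) simp
  next
    case False
    then show False using arg_cong[OF assms(1), of "\<lambda>l. l ! c"] assms(3) \<open>a \<noteq> c\<close> by (simp only: nth) simp
  qed
qed

text \<open>The middle block is nonempty and its entries are large, so \<open>a\<close> is the
  length of the longest initial run 1, 2, ...; the last entry is \<open>a + b\<close>. Thus the
  choice by \<open>SOME\<close> in \<open>psi_q\<close> is determined.\<close>

lemma sandwiched_unique:
  assumes "is_perm \<sigma>" "\<sigma> \<noteq> ident (length \<sigma>)" "sandwiched a b \<sigma>" "sandwiched c d \<sigma>"
  shows "a = c \<and> b = d"
proof -
  obtain s s' where 1: "\<sigma> = [1..<a + 1] @ s @ [a + 1..<a + b + 1]" "1 \<le> b"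
    and 2: "\<sigma> = [1..<c + 1] @ s' @ [c + 1..<c + d + 1]" "1 \<le> d"
    using assms(3,4) unfolding sandwiched_iff by blast
  have app: "[1..<m + 1] @ [m + 1..<m + k + 1] = ident (m + k)" for m k
    unfolding ident_def using upt_add_eq_append[of 1 "m + 1" k] by (simp add: add.commute)
  have "s \<noteq> []"
  proof
    assume "s = []"
    then have "\<sigma> = ident (a + b)" using 1(1) app by simp
    then show False using assms(2) by (simp add: ident_def)
  qed
  moreover have "s' \<noteq> []"
  proof
    assume "s' = []"
    then have "\<sigma> = ident (c + d)" using 2(1) app by simp
    then show False using assms(2) by (simp add: ident_def)
  qed
  ultimately obtain x xs y ys where xy: "s = x # xs" "s' = y # ys" by (metis list.exhaust)
  have "a + b < x" "c + d < y" using assms(1) sandwich_gt[of a s b x] sandwich_gt[of c s' d y] 1 2 xy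
    by auto
  then have "a = c" using upt_prefix_eqD[of a x "xs @ [a + 1..<a + b + 1]" c y "ys @ [c + 1..<c + d + 1]"]
      1 2 xy by auto
  moreover have "last (u @ v @ [m + 1..<m + k + 1]) = m + k" if "1 \<le> k" for u v m k
    using that by simp
  then have "last \<sigma> = a + b" "last \<sigma> = c + d" using 1 2 by metis+
  ultimately show ?thesis by simp
qed

text \<open>The values up to \<open>a + b\<close> form the two outer blocks and increase across
  them, while \<open>a + b + 1\<close> lies in the middle block and so precedes
  \<open>a + b\<close>, the last entry.\<close>

lemma min_recoil_sandwiched:
  assumes "is_perm \<sigma>" "\<sigma> = [1..<a + 1] @ s @ [a + 1..<a + b + 1]" "1 \<le> b" "s \<noteq> []"
  shows "min_recoil \<sigma> = a + b" "before \<sigma> (a + b + 1) (a + b)"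
proof -
  let ?t = "a + b"
  have d: "distinct \<sigma>" and st: "set \<sigma> = {1..length \<sigma>}" using assms(1) by (auto simp: is_perm_def)
  have gt: "?t < x" if "x \<in> set s" for x using sandwich_gt assms that by blast
  have l: "length \<sigma> = a + length s + b" by (simp add: assms(2))
  have "0 < length s" using assms(4) by simp
  then have "?t + 1 \<in> set \<sigma>" unfolding st l by (simp add: Suc_le_eq)
  then have m: "?t + 1 \<in> set s" by (auto simp: assms(2))
  show rec: "before \<sigma> (?t + 1) ?t" using m assms(3) by (auto simp: assms(2) before_append)
  show t: "min_recoil \<sigma> = ?t"
  proof (rule min_recoil_eqI[OF d])
    show "1 \<le> ?t" using assms(3) by simp
    show "?t < length \<sigma>" using l \<open>0 < length s\<close> by simp
    show "before \<sigma> (?t + 1) ?t" by (rule rec)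
    show "before \<sigma> i (i + 1)" if "1 \<le> i" "i < ?t" for i
      using that by (auto simp: assms(2) before_append before_upt)
  qed
qed

lemma not_ident_if_before:
  assumes "before \<sigma> x y" "y < x"
  shows "\<sigma> \<noteq> ident n"
  using assms unfolding ident_def by (auto simp: before_upt)

lemma map_shift_sandwich:
  assumes "\<forall>x\<in>set s. a + b < x"
  shows "map (shift (a + b + 1)) ([1..<a + 1] @ s @ [a + 1..<a + b + 1])
    = [1..<a + 1] @ map Suc s @ [a + 1..<a + b + 1]"
proof -
  have "map (shift (a + b + 1)) [1..<a + 1] = [1..<a + 1]"
    "map (shift (a + b + 1)) [a + 1..<a + b + 1] = [a + 1..<a + b + 1]"
    by (intro map_shift_below; force)+
  moreover have "map (shift (a + b + 1)) s = map Suc s" using assms by (intro map_shift_above) force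
  ultimately show ?thesis by simp
qed

text \<open>\<open>gamma\<close> takes \<open>a + 1\<close>, the first entry of the final block, and
  puts it right behind 1, ..., a. The result is the head \<open>a + b + 1\<close> followed by a
  sandwich shape whose first block has grown and whose last block has shrunk by one.\<close>

lemma psi_q_sandwiched:
  assumes "is_perm \<sigma>" "\<sigma> = [1..<a + 1] @ s @ [a + 1..<a + b + 1]" "1 \<le> b" "s \<noteq> []"
  shows "psi_q \<sigma> = (a + b + 1) # [1..<a + 2] @ map Suc s @ [a + 2..<a + b + 1]"
proof -
  let ?t = "a + b"
  note t = min_recoil_sandwiched(1)[OF assms]
  have ni: "\<sigma> \<noteq> ident (length \<sigma>)"
    using min_recoil_sandwiched(2)[OF assms] by (rule not_ident_if_before) simp
  have gt: "?t < x" if "x \<in> set s" for x using sandwich_gt assms that by blast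
  have l: "length \<sigma> = a + length s + b" by (simp add: assms(2))
  have sw: "sandwiched a b \<sigma>" unfolding sandwiched_iff using assms(2,3) by blast
  have some: "(SOME ab. sandwiched (fst ab) (snd ab) \<sigma>) = (a, b)"
  proof (rule some_equality)
    show "sandwiched (fst (a, b)) (snd (a, b)) \<sigma>" using sw by simp
    show "ab = (a, b)" if "sandwiched (fst ab) (snd ab) \<sigma>" for ab
      using sandwiched_unique[OF assms(1) ni that sw] by (simp add: prod_eq_iff)
  qed
  have sh: "map (shift (?t + 1)) \<sigma> = [1..<a + 1] @ map Suc s @ [a + 1..<a + b + 1]"
    unfolding assms(2) using gt by (intro map_shift_sandwich) blast
  have up: "[a + 1..<a + b + 1] = (a + 1) # [a + 2..<a + b + 1]"
    using assms(3) upt_conv_Cons[of "a + 1" "a + b + 1"] by simp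
  \<comment> \<open>\<open>?u\<close> is everything in front of the entry that moves. Its length is
    one less than the position \<open>length \<sigma> - b + 2\<close>, which counts from 1.\<close>
  let ?u = "(?t + 1) # [1..<a + 1] @ map Suc s"
  have lu: "length ?u = length \<sigma> - b + 1" using l by simp
  have r: "rho (?t + 1) 1 \<sigma> = ?u @ (a + 1) # [a + 2..<a + b + 1]"
    unfolding rho_front sh up by simp
  have "gamma (length \<sigma> - b + 2) (a + 2) (?u @ (a + 1) # [a + 2..<a + b + 1])
      = take (a + 1) (?u @ [a + 2..<a + b + 1]) @ [a + 1] @ drop (a + 1) (?u @ [a + 2..<a + b + 1])"
  proof -
    have e: "length \<sigma> - b + 2 = length ?u + 1" "a + 2 - 1 = a + 1" using lu by auto
    have x: "take (length u) (u @ x # v) = u" "drop (length u + 1) (u @ x # v) = v" "(u @ x # v) ! length u = x"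
      for u v :: "nat list" and x by auto
    show ?thesis unfolding gamma_def Let_def e add_diff_cancel_right' x ..
  qed
  also have "\<dots> = (?t + 1) # [1..<a + 1] @ [a + 1] @ map Suc s @ [a + 2..<a + b + 1]"
    by simp
  also have "\<dots> = (?t + 1) # [1..<a + 2] @ map Suc s @ [a + 2..<a + b + 1]"
    using upt_Suc_append[of 1 "a + 1"] by simp
  finally show ?thesis using sw some r t unfolding psi_q_def Let_def by auto
qed

lemma psi_q_not_sandwiched:
  assumes "\<And>a b. \<not> sandwiched a b \<sigma>"
  shows "psi_q \<sigma> = (min_recoil \<sigma> + 1) # map (shift (min_recoil \<sigma> + 1)) \<sigma>"
  using assms unfolding psi_q_def Let_def rho_front by simp

section \<open>The operator \<open>Q\<close>\<close>

text \<open>With \<open>h\<close> as first entry, each of 4132, 4213 and 3214 contains a decreasing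
  pair of values below \<open>h\<close>, which \<open>inc\<close> forbids. Only 2413 remains, with
  \<open>h\<close> as its 2.\<close>

lemma evil_free_Cons:
  assumes "evil_free \<rho>" "distinct (h # \<rho>)"
    and inc: "\<And>i j. i \<in> set \<rho> \<Longrightarrow> i < j \<Longrightarrow> j \<in> set \<rho> \<Longrightarrow> j < h \<Longrightarrow> before \<rho> i j"
    and no_2413: "\<And>b c d. before \<rho> b c \<Longrightarrow> before \<rho> c d \<Longrightarrow> c < h \<Longrightarrow> h < d \<Longrightarrow> d < b \<Longrightarrow> False"
  shows "evil_free (h # \<rho>)"
  unfolding evil_free_def
proof (intro allI impI)
  fix a b c d
  assume *: "before (h # \<rho>) a b" "before (h # \<rho>) b c" "before (h # \<rho>) c d"
  have d: "distinct \<rho>" and h: "h \<notin> set \<rho>" using assms(2) by auto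
  have mem: "y \<in> set \<rho>" if "before (h # \<rho>) x y" for x y
    using that before_set[of \<rho> x y] by auto
  have bc: "before \<rho> b c" using *(2) mem[OF *(1)] h by auto
  have cd: "before \<rho> c d" using *(3) mem[OF *(2)] h by auto
  have m: "b \<in> set \<rho>" "c \<in> set \<rho>" "d \<in> set \<rho>" using mem * by blast+
  have 1: "\<not> c < b" if "b < h" using inc[OF m(2) _ m(1) that] before_asym[OF d bc] by blast
  have 2: "\<not> d < c" if "c < h" using inc[OF m(3) _ m(2) that] before_asym[OF d cd] by blast
  show "\<not> (c < a \<and> a < d \<and> d < b) \<and> \<not> (b < d \<and> d < c \<and> c < a) \<and>
     \<not> (c < b \<and> b < d \<and> d < a) \<and> \<not> (c < b \<and> b < a \<and> a < d)"
  proof (cases "a = h")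
    case True
    then show ?thesis using 1 2 no_2413[OF bc cd] by (meson less_trans)
  next
    case False
    then have "before \<rho> a b" using *(1) by simp
    then show ?thesis using bc cd assms(1) unfolding evil_free_def by blast
  qed
qed

text \<open>Let \<open>t + 1\<close>, \<open>b\<close>, \<open>c\<close>, \<open>d\<close> form a
  2413. The position of \<open>t + 2\<close> then yields a pattern that avoids the new head: if it
  precedes \<open>b\<close>, then \<open>t + 2\<close>, \<open>b\<close>, \<open>c\<close>,
  \<open>d\<close> is a 2413; if it is between \<open>b\<close> and \<open>c\<close>, then
  \<open>b\<close>, \<open>t + 2\<close>, \<open>c\<close>, \<open>d\<close> is a 4213; if it
  follows \<open>c\<close>, then \<open>b\<close>, \<open>c\<close>, \<open>t + 2\<close>,
  \<open>t\<close> is a 4132, by the recoil.\<close>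

lemma evil_free_Cons_recoil:
  assumes e: "evil_free \<rho>" and dis: "distinct ((t + 1) # \<rho>)" and r: "before \<rho> (t + 2) t"
    and inc: "\<And>i j. i \<in> set \<rho> \<Longrightarrow> i < j \<Longrightarrow> j \<in> set \<rho> \<Longrightarrow> j < t + 1 \<Longrightarrow> before \<rho> i j"
  shows "evil_free ((t + 1) # \<rho>)"
proof (rule evil_free_Cons[OF e dis])
  fix b c d
  assume bc: "before \<rho> b c" and cd: "before \<rho> c d" and lt: "c < t + 1" "t + 1 < d" "d < b"
  have d: "distinct \<rho>" using dis by simp
  have m: "b \<in> set \<rho>" "c \<in> set \<rho>" "t + 2 \<in> set \<rho>" using bc r before_set by metis+
  have bd: "before \<rho> b d" using bc cd d before_trans by metis
  show False
  proof (cases "before \<rho> (t + 2) b")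
    case True
    then have "d \<noteq> t + 2" using bd before_asym[OF d] by metis
    then show False using evil_freeD(1)[OF e True bc cd] lt by linarith
  next
    case False
    then have b: "before \<rho> b (t + 2)" using before_total[OF m(1,3)] lt by auto
    show False
    proof (cases "before \<rho> (t + 2) c")
      case True
      then have "d \<noteq> t + 2" using cd before_asym[OF d] by metis
      then show False using evil_freeD(3)[OF e b True cd] lt by linarith
    next
      case False
      then have c: "before \<rho> c (t + 2)" using before_total[OF m(2,3)] lt by auto
      have "c \<noteq> t" using False r by metis
      then show False using evil_freeD(2)[OF e bc c r] lt by linarith
    qed
  qed
qed (use inc in blast)

lemma evil_free_sandwich:
  assumes "evil_free s" "distinct s" "\<And>x. x \<in> set s \<Longrightarrow> a + b < x"
  shows "evil_free ([1..<a + 1] @ s @ [a + 1..<a + b + 1])"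
proof (rule evil_free_prepend_smaller)
  show "evil_free (s @ [a + 1..<a + b + 1])"
    using assms by (intro evil_free_append_smaller) fastforce+
qed (use assms in fastforce)+

text \<open>A 2413 that starts with the new head would have its 4 and its 3 in \<open>s\<close> and
  its 1 outside of \<open>s\<close>, although it stands between them; but \<open>s\<close> is a
  contiguous block. The case \<open>b = 0\<close>, an empty last block, is included.\<close>

lemma evil_free_Cons_sandwich:
  assumes "evil_free s" "distinct s" "\<And>x. x \<in> set s \<Longrightarrow> a + b + 1 < x"
  shows "evil_free ((a + b + 1) # [1..<a + 1] @ s @ [a + 1..<a + b + 1])"
proof (rule evil_free_Cons)
  let ?A = "[1..<a + 1]" and ?C = "[a + 1..<a + b + 1]"
  show "evil_free (?A @ s @ ?C)"
    using assms by (intro evil_free_sandwich) fastforce+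
  show "distinct ((a + b + 1) # ?A @ s @ ?C)"
    using assms(2,3) by fastforce
  show "before (?A @ s @ ?C) i j"
    if "i \<in> set (?A @ s @ ?C)" "i < j" "j \<in> set (?A @ s @ ?C)" "j < a + b + 1" for i j
  proof -
    have "i \<notin> set s" "j \<notin> set s" using that assms(3)[of i] assms(3)[of j] by auto
    then show ?thesis using that by (auto simp: before_append before_upt)
  qed
  show False
    if "before (?A @ s @ ?C) x y" "before (?A @ s @ ?C) y z" "y < a + b + 1" "a + b + 1 < z" "z < x"
    for x y z
  proof -
    have z: "z \<in> set s" and x: "x \<in> set s"
      using before_set[OF that(1)] before_set[OF that(2)] that(4,5) by auto
    have y: "y \<notin> set s" using that(3) assms(3)[of y] by auto
    have "y \<in> set ?C" using that(1) x y assms(3)[OF x] by (auto simp: before_append before_upt dest: before_set)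
    then show False using that(2) y z assms(3)[OF z] by (auto simp: before_append before_upt dest: before_set)
  qed
qed

section \<open>The image of the operator \<open>Q\<close>\<close>

lemma evil_free_appendD: "evil_free (us @ s @ vs) \<Longrightarrow> evil_free s"
  by (erule evil_free_mono) (auto simp: before_append)

text \<open>The working form of \<open>psi_q\<close> for all arguments in its domain. In the
  sandwiched case the middle block is nonempty because the identity is excluded.\<close>

lemma psi_q_cases:
  assumes "dom_op Q \<sigma>"
  obtains (sandwiched) a b s where "\<sigma> = [1..<a + 1] @ s @ [a + 1..<a + b + 1]" "1 \<le> b" "s \<noteq> []"
      "psi_q \<sigma> = (a + b + 1) # [1..<a + 2] @ map Suc s @ [a + 2..<a + b + 1]"
      "\<forall>x\<in>set s. a + b < x"
  | (plain) t where "\<And>a b. \<not> sandwiched a b \<sigma>" "t = min_recoil \<sigma>"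
      "psi_q \<sigma> = (t + 1) # map (shift (t + 1)) \<sigma>"
proof (cases "\<exists>a b. sandwiched a b \<sigma>")
  case True
  then obtain a b s where *: "\<sigma> = [1..<a + 1] @ s @ [a + 1..<a + b + 1]" "1 \<le> b"
    unfolding sandwiched_iff by blast
  have p: "is_perm \<sigma>" using assms by (simp add: evil_avoiding_iff)
  have "s \<noteq> []"
  proof
    assume "s = []"
    then have "\<sigma> = [1..<a + b + 1]" using * upt_add_eq_append[of 1 "a + 1" b] by (simp add: add.commute)
    then show False using assms by (auto simp: ident_def)
  qed
  then show ?thesis using * sandwiched psi_q_sandwiched[OF p *] sandwich_gt p by blast
next
  case False
  then show ?thesis using plain psi_q_not_sandwiched by blast
qed

lemma is_perm_Cons_shift:
  "1 \<le> h \<Longrightarrow> h \<le> length \<sigma> + 1 \<Longrightarrow> is_perm (h # map (shift h) \<sigma>) \<longleftrightarrow> is_perm \<sigma>"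
  using is_perm_insert[of h "[]" \<sigma>] by simp

lemma is_perm_move: "is_perm (us @ x # vs @ ws) \<longleftrightarrow> is_perm (us @ vs @ x # ws)"
  by (auto simp: is_perm_def)

lemma ends_before:
  assumes "ends k \<tau>" "1 \<le> k" "x \<in> set \<tau>" "k < x"
  shows "before \<tau> x 1"
  using assms by (auto simp: ends_def before_append)

lemma evil_avoiding_psi_Q:
  assumes "dom_op Q \<sigma>"
  shows "evil_avoiding (psi_q \<sigma>)"
proof -
  have p: "is_perm \<sigma>" and e: "evil_free \<sigma>" and n: "\<sigma> \<noteq> ident (length \<sigma>)"
    using assms by (auto simp: evil_avoiding_iff)
  from assms show ?thesis
  proof (cases rule: psi_q_cases)
    case (sandwiched a b s)
    obtain c where c: "b = Suc c" using sandwiched(2) by (cases b) auto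
    \<comment> \<open>The insertion by \<open>rho\<close> yields a permutation, and
      \<open>gamma\<close> only moves the entry \<open>a + 1\<close>.\<close>
    have "is_perm ((a + b + 1) # map (shift (a + b + 1)) \<sigma>)"
      using p sandwiched(1,3) by (subst is_perm_Cons_shift) auto
    then have "is_perm ((a + b + 1) # [1..<a + 1] @ map Suc s @ [a + 1..<a + b + 1])"
      unfolding sandwiched(1) map_shift_sandwich[OF sandwiched(5)] .
    also have "[a + 1..<a + b + 1] = (a + 1) # [a + 2..<a + b + 1]"
      using sandwiched(2) upt_conv_Cons[of "a + 1" "a + b + 1"] by simp
    finally have "is_perm (((a + b + 1) # [1..<a + 1]) @ (a + 1) # map Suc s @ [a + 2..<a + b + 1])"
      unfolding is_perm_move by simp
    then have "is_perm (psi_q \<sigma>)"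
      using upt_Suc_append[of 1 "a + 1"] unfolding sandwiched(4) by simp
    moreover have "evil_free s" "distinct s" using e p unfolding sandwiched(1)
      by (auto simp: is_perm_def intro: evil_free_appendD)
    then have "evil_free (map Suc s)" "distinct (map Suc s)"
      by (auto simp: evil_free_map strict_mono_Suc_iff distinct_map)
    \<comment> \<open>Behind the head stands a sandwich shape with parameters \<open>a + 1\<close>
      and \<open>c\<close>, where \<open>c\<close> is \<open>b - 1\<close>.\<close>
    then have "evil_free (psi_q \<sigma>)"
      using evil_free_Cons_sandwich[of "map Suc s" "a + 1" c] sandwiched(5)
      unfolding sandwiched(4) by (fastforce simp: c)
    ultimately show ?thesis by (simp add: evil_avoiding_iff)
  next
    case (plain t)
    note t = min_recoil_props[OF p n, folded plain(2)]
    let ?\<rho> = "map (shift (t + 1)) \<sigma>"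
    have pp: "is_perm ((t + 1) # ?\<rho>)" using p t(2) by (subst is_perm_Cons_shift) auto
    have "evil_free ((t + 1) # ?\<rho>)"
    proof (rule evil_free_Cons_recoil)
      show "evil_free ?\<rho>" using e by (simp add: evil_free_map strict_mono_shift)
      show "distinct ((t + 1) # ?\<rho>)" using pp by (simp only: is_perm_def)
      show "before ?\<rho> (t + 2) t"
        using t(3) before_map_inj[OF inj_shift, of "t + 1" \<sigma> "t + 1" t] by (simp add: shift_def)
      show "before ?\<rho> i j" if "i \<in> set ?\<rho>" "i < j" "j \<in> set ?\<rho>" "j < t + 1" for i j
      proof -
        have "1 \<le> i" using that(1) is_perm_pos[OF pp] by auto
        then have "before \<sigma> i j" using that t(4) by simp
        then show ?thesis using that before_map_inj[OF inj_shift, of "t + 1" \<sigma> i j] by (simp add: shift_def)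
      qed
    qed
    then show ?thesis using pp plain(3) by (simp add: evil_avoiding_iff)
  qed
qed

lemma hd_psi_Q:
  assumes "dom_op Q \<sigma>"
  shows "hd (psi_q \<sigma>) \<noteq> 1"
  using assms
proof (cases rule: psi_q_cases)
  case (plain t)
  have "is_perm \<sigma>" "\<sigma> \<noteq> ident (length \<sigma>)" using assms by (auto simp: evil_avoiding_iff)
  then show ?thesis using min_recoil_props(1)[of \<sigma>] plain by simp
qed simp

text \<open>Here the correction by \<open>gamma\<close> takes effect. In the sandwiched case 1
  precedes the middle block, whose entries exceed \<open>k\<close> and would have to precede a final
  run. In the plain case the head exceeds \<open>k\<close>, so a final run 1, ..., k would already
  be present in the argument and make it sandwiched with \<open>a = 0\<close>.\<close>

lemma not_ends_psi_Q:
  assumes "dom_op Q \<sigma>" "1 \<le> k"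
  shows "\<not> ends k (psi_q \<sigma>)"
proof
  assume en: "ends k (psi_q \<sigma>)"
  have d: "distinct (psi_q \<sigma>)" using evil_avoiding_psi_Q[OF assms(1)]
    by (simp add: evil_avoiding_iff is_perm_def)
  from en obtain us where us: "psi_q \<sigma> = us @ [1..<k + 1]" by (auto simp: ends_def)
  have "us \<noteq> []"
  proof
    assume "us = []"
    then have "psi_q \<sigma> = 1 # [2..<k + 1]" using us assms(2) upt_conv_Cons[of 1 "k + 1"]
      by (simp add: numeral_2_eq_2)
    then show False using hd_psi_Q[OF assms(1)] by simp
  qed
  then obtain h us' where h: "us = h # us'" by (cases us) auto
  then have hk: "k < h" using us d is_perm_pos[of "psi_q \<sigma>" h] evil_avoiding_psi_Q[OF assms(1)]
    by (auto simp: evil_avoiding_iff)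
  from assms(1) show False
  proof (cases rule: psi_q_cases)
    case (sandwiched a b s)
    obtain x where x: "x \<in> set s" using sandwiched(3) by (cases s) auto
    have "h = a + b + 1" using us h sandwiched(4) by simp
    then have "k < Suc x" using hk sandwiched(5) x by fastforce
    moreover have "Suc x \<in> set (psi_q \<sigma>)" using x sandwiched(4) by simp
    ultimately have "before (psi_q \<sigma>) (Suc x) 1" using ends_before[OF en assms(2)] by blast
    moreover have "before (psi_q \<sigma>) 1 (Suc x)" using x sandwiched(4) by (simp add: before_append)
    ultimately show False using before_asym[OF d] by blast
  next
    case (plain t)
    then have "map (shift (t + 1)) \<sigma> = us' @ [1..<k + 1]" "h = t + 1" using us h by auto
    then obtain u v where uv: "\<sigma> = u @ v" "map (shift (t + 1)) v = [1..<k + 1]"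
      by (auto simp: map_eq_append_conv)
    have "map (shift (t + 1)) [1..<k + 1] = [1..<k + 1]"
      using hk \<open>h = t + 1\<close> by (intro map_shift_below) auto
    then have "v = [1..<k + 1]" using uv(2) map_shift_eq_iff by metis
    then have "sandwiched 0 k \<sigma>" unfolding sandwiched_iff using uv(1) assms(2)
      by (intro conjI exI[of _ u]) simp_all
    then show False using plain(1) by blast
  qed
qed

text \<open>The two forms of \<open>psi_q\<close> never give the same list. Deleting the common head
  leaves \<sigma>' = 1, ..., a + 1, s, a + 2, ..., a + b. For \<open>b = 1\<close> its smallest
  recoil cannot be \<open>a + 1\<close>, as \<open>a + 2\<close> does not precede
  \<open>a + 1\<close>; for larger \<open>b\<close> it is sandwiched with parameters
  \<open>a + 1\<close> and \<open>b - 1\<close>.\<close>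

lemma psi_Q_sandwiched_neq_plain:
  assumes "dom_op Q \<sigma>'" "1 \<le> b" "\<forall>x\<in>set s. a + b < x"
    "\<And>a b. \<not> sandwiched a b \<sigma>'" "t = min_recoil \<sigma>'"
  shows "(a + b + 1) # [1..<a + 2] @ map Suc s @ [a + 2..<a + b + 1] \<noteq> (t + 1) # map (shift (t + 1)) \<sigma>'"
proof
  assume eq: "(a + b + 1) # [1..<a + 2] @ map Suc s @ [a + 2..<a + b + 1] = (t + 1) # map (shift (t + 1)) \<sigma>'"
  obtain c where c: "b = Suc c" using assms(2) by (cases b) auto
  have t: "t = a + b" using eq by simp
  have "map (shift (t + 1)) \<sigma>' = map (shift (t + 1)) ([1..<a + 2] @ s @ [a + 2..<a + b + 1])"
    using eq map_shift_sandwich[of s "a + 1" c] assms(3) by (simp add: t c)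
  then have \<sigma>': "\<sigma>' = [1..<a + 2] @ s @ [a + 2..<a + b + 1]" by (simp only: map_shift_eq_iff)
  show False
  proof (cases c)
    case 0
    have "is_perm \<sigma>'" "\<sigma>' \<noteq> ident (length \<sigma>')" using assms(1) by (auto simp: evil_avoiding_iff)
    then have "before \<sigma>' (t + 1) t" using min_recoil_props(3) assms(5) by blast
    then have "before ([1..<a + 2] @ s) (a + 2) (a + 1)" using \<sigma>' t c 0 by simp
    moreover have "a + 1 \<notin> set s" using assms(3) c by auto
    ultimately show False using before_set[of s "a + 2" "a + 1"]
      by (auto simp: before_append before_upt)
  next
    case (Suc e)
    then have "sandwiched (a + 1) c \<sigma>'" unfolding sandwiched_iff using \<sigma>'
      by (intro conjI exI[of _ s]) (simp_all add: c)
    then show False using assms(4) by blast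
  qed
qed

text \<open>In the plain form the head gives \<open>t\<close>, and deleting it gives the argument.
  In the sandwiched form the head gives \<open>a + b\<close>, and the run behind it has length
  \<open>a + 1\<close>, which then determines \<open>s\<close>.\<close>

lemma psi_Q_inj:
  assumes "dom_op Q \<sigma>" "dom_op Q \<sigma>'" "psi_q \<sigma> = psi_q \<sigma>'"
  shows "\<sigma> = \<sigma>'"
  using assms(1)
proof (cases rule: psi_q_cases)
  case sand: (sandwiched a b s)
  from assms(2) show ?thesis
  proof (cases rule: psi_q_cases)
    case sand': (sandwiched a' b' s')
    have ab: "a + b = a' + b'" using assms(3) sand(4) sand'(4) by simp
    obtain x xs y ys where xy: "s = x # xs" "s' = y # ys"
      using sand(3) sand'(3) by (metis list.exhaust)
    have "[1..<(a + 1) + 1] @ Suc x # map Suc xs @ [a + 2..<a + b + 1]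
      = [1..<(a' + 1) + 1] @ Suc y # map Suc ys @ [a' + 2..<a' + b' + 1]"
      using arg_cong[OF assms(3), of tl] unfolding sand(4) sand'(4) list.sel xy by simp
    moreover have "a + 1 + 1 < Suc x" "a' + 1 + 1 < Suc y"
      using sand(5) sand'(5) sand(2) sand'(2) by (simp_all add: xy)
    ultimately have "a = a'" using upt_prefix_eqD by (metis add_right_cancel)
    moreover from this ab have "b = b'" by simp
    moreover have "s = s'" using assms(3) calculation unfolding sand(4) sand'(4) by simp
    ultimately show ?thesis using sand(1) sand'(1) by simp
  next
    case plain: (plain t)
    then show ?thesis
      using psi_Q_sandwiched_neq_plain[OF assms(2) sand(2,5) plain(1,2)] assms(3)[unfolded sand(4) plain(3)] by blast
  qed
next
  case plain: (plain t)
  from assms(2) show ?thesis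
  proof (cases rule: psi_q_cases)
    case sand: (sandwiched a b s)
    then show ?thesis
      using psi_Q_sandwiched_neq_plain[OF assms(1) sand(2,5) plain(1,2)] assms(3)[unfolded sand(4) plain(3)] by metis
  next
    case plain': (plain t')
    have "t = t'" and "map (shift (t + 1)) \<sigma> = map (shift (t' + 1)) \<sigma>'"
      using assms(3) unfolding plain(3) plain'(3) by auto
    then show ?thesis by (simp add: map_shift_eq_iff)
  qed
qed

section \<open>Preimages under the operator \<open>Q\<close>\<close>

lemma before_last:
  assumes "distinct (xs @ [l])" "x \<in> set (xs @ [l])" "x \<noteq> l"
  shows "before (xs @ [l]) x l"
  using assms by (auto simp: before_append)

text \<open>A decreasing pair \<open>y\<close>, \<open>x\<close> below the head is completed to a
  forbidden pattern with the help of 1, the last entry \<open>l\<close>, and an entry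
  \<open>z\<close> behind 1 with \<open>l < z\<close>, which exists because there is no final
  run.\<close>

lemma below_head_increasing:
  assumes ev: "evil_avoiding (h # \<rho>)" and h: "h \<noteq> 1" and ends: "\<And>k. 1 \<le> k \<Longrightarrow> \<not> ends k (h # \<rho>)"
    and xy: "1 \<le> x" "x < y" "y < h"
  shows "before \<rho> x y"
proof (rule ccontr)
  assume nb: "\<not> before \<rho> x y"
  have p: "is_perm (h # \<rho>)" and e: "evil_free (h # \<rho>)" using ev by (auto simp: evil_avoiding_iff)
  have d: "distinct \<rho>" and hn: "h \<notin> set \<rho>" using p by (auto simp: is_perm_def)
  have st: "set (h # \<rho>) = {1..length (h # \<rho>)}" using p by (simp only: is_perm_def)
  have "h \<in> {1..length (h # \<rho>)}" unfolding st[symmetric] by simp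
  then have mem: "i \<in> set \<rho>" if "1 \<le> i" "i < h" for i
  proof -
    have "i \<in> set (h # \<rho>)" unfolding st using that \<open>h \<in> {1..length (h # \<rho>)}\<close> by auto
    then show ?thesis using that by simp
  qed
  have pos: "1 \<le> i" if "i \<in> set \<rho>" for i using is_perm_pos[OF p] that by simp
  have bh: "before (h # \<rho>) h i" if "i \<in> set \<rho>" for i using that by simp
  have bI: "before (h # \<rho>) i j" if "before \<rho> i j" for i j using that by simp
  note evD = evil_freeD[OF e bh bI bI]
  have xm: "x \<in> set \<rho>" and ym: "y \<in> set \<rho>" and om: "1 \<in> set \<rho>" using xy mem by auto
  have yx: "before \<rho> y x" using before_total[OF xm ym] nb xy by auto
  obtain \<rho>' l where \<rho>: "\<rho> = \<rho>' @ [l]" using xm by (cases \<rho> rule: rev_cases) auto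
  have lm: "l \<in> set \<rho>" using \<rho> by simp
  have bl: "before \<rho> i l" if "i \<in> set \<rho>" "i \<noteq> l" for i
    using that before_last[of \<rho>' l i] d unfolding \<rho> by blast
  have "l \<noteq> h" using lm hn by auto
  \<comment> \<open>Otherwise \<open>h\<close>, \<open>y\<close>, \<open>x\<close>, \<open>l\<close>
    is a 3214.\<close>
  moreover have "\<not> h < l"
  proof
    assume "h < l"
    then show False using evD(4)[OF ym yx bl[OF xm]] xy by auto
  qed
  ultimately have lh: "l < h" by simp
  have l1: "l \<noteq> 1"
  proof
    assume "l = 1"
    then have "ends 1 (h # \<rho>)" unfolding ends_def \<rho> by (intro exI[of _ "h # \<rho>'"]) (simp add: upt_Suc)
    then show False using ends by blast
  qed
  \<comment> \<open>A decreasing pair \<open>j\<close>, \<open>i\<close> below \<open>l\<close>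
    would make \<open>h\<close>, \<open>j\<close>, \<open>i\<close>, \<open>l\<close> a
    4213.\<close>
  have small: "before \<rho> i j" if "1 \<le> i" "i < j" "j < l" for i j
  proof (rule ccontr)
    assume "\<not> before \<rho> i j"
    moreover have m: "i \<in> set \<rho>" "j \<in> set \<rho>" using mem that lh by auto
    ultimately have "before \<rho> j i" using before_total[OF m] that by auto
    then show False using evD(3)[OF m(2) _ bl[OF m(1)]] that lh by auto
  qed
  \<comment> \<open>If all entries behind 1 were at most \<open>l\<close>, they would be exactly 2,
    ..., l by \<open>small\<close>, in increasing order, and the list would end with 1, ...,
    l.\<close>
  have "\<exists>z. before \<rho> 1 z \<and> l < z"
  proof (rule ccontr)
    assume nz: "\<nexists>z. before \<rho> 1 z \<and> l < z"
    obtain us vs where uv: "\<rho> = us @ 1 # vs" using om split_list by metis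
    have b1: "before \<rho> 1 i \<longleftrightarrow> i \<in> set vs" for i
      using d before_set[of us 1 i] before_set[of vs 1 i] unfolding uv by (auto simp: before_append)
    have "1 # vs = [1..<l + 1]"
    proof (rule eq_upt_if_before)
      have ge: "i \<in> set vs" if "1 < i" "i \<le> l" for i
      proof (cases "i = l")
        case True
        then show ?thesis using b1 bl[OF om] l1 by metis
      next
        case False
        then show ?thesis using b1 small[of 1 i] that by auto
      qed
      have le: "i \<le> l \<and> 1 \<le> i" if "i \<in> set vs" for i
      proof -
        have "before \<rho> 1 i" using b1 that by blast
        then have "\<not> l < i" using nz by blast
        moreover have "1 \<le> i" using pos that unfolding uv by simp
        ultimately show ?thesis by simp
      qed
      have "1 \<le> l" using pos lm by blast
      show set: "set (1 # vs) = {1..<l + 1}"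
      proof (intro set_eqI iffI)
        show "i \<in> {1..<l + 1}" if "i \<in> set (1 # vs)" for i
          using that le[of i] \<open>1 \<le> l\<close> by auto
        show "i \<in> set (1 # vs)" if "i \<in> {1..<l + 1}" for i
          using that ge[of i] by (cases "i = 1") auto
      qed
      fix a b assume "before (1 # vs) a b"
      then have ab: "before \<rho> a b" and m: "a \<in> {1..<l + 1}" "b \<in> {1..<l + 1}"
        using before_set[of "1 # vs" a b] unfolding set unfolding uv by (auto simp: before_append)
      have ne: "a \<noteq> b" and nba: "\<not> before \<rho> b a" using before_irrefl[OF d ab] before_asym[OF d ab] .
      show "a < b"
      proof (rule ccontr)
        assume "\<not> a < b"
        then have ba: "b < a" using ne by simp
        have "before \<rho> b a"
        proof (cases "a = l")
          case True
          then show ?thesis using bl before_set[OF ab] ne by metis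
        next
          case False
          then show ?thesis using small[of b a] m ba by simp
        qed
        then show False using nba by blast
      qed
    qed
    then have "h # \<rho> = (h # us) @ [1..<l + 1]" unfolding uv by simp
    then have "ends l (h # \<rho>)" unfolding ends_def by blast
    then show False using ends pos lm by blast
  qed
  then obtain z where z: "before \<rho> 1 z" "l < z" by blast
  have zm: "z \<in> set \<rho>" using before_set[OF z(1)] by simp
  have "1 < l" using l1 pos[OF lm] by simp
  \<comment> \<open>Otherwise \<open>h\<close>, 1, \<open>z\<close>, \<open>l\<close> is a
    4132.\<close>
  then have "\<not> z < h" using evD(2)[OF om z(1) bl[OF zm]] z(2) by auto
  then have hz: "h < z" using zm hn by (metis linorder_neqE_nat)
  \<comment> \<open>Otherwise \<open>h\<close>, \<open>y\<close>, \<open>x\<close>, \<open>z\<close>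
    is a 3214.\<close>
  have "\<not> before \<rho> x z" using evD(4)[OF ym yx] hz xy by auto
  then have zx: "before \<rho> z x" using before_total[OF xm zm] hz xy by auto
  have x1: "before \<rho> 1 x" using before_trans[OF d z(1) zx] .
  then have "x \<noteq> 1" using before_irrefl[OF d] by blast
  \<comment> \<open>Both positions of \<open>y\<close> are impossible: \<open>h\<close>,
    \<open>y\<close>, 1, \<open>z\<close> would be a 3214, and \<open>h\<close>, 1,
    \<open>y\<close>, \<open>x\<close> a 4132.\<close>
  have "before \<rho> y 1 \<or> before \<rho> 1 y" using before_total[OF ym om] xy by auto
  then show False
  proof
    assume "before \<rho> y 1"
    then show False using evD(4)[OF ym _ z(1)] xy hz by auto
  next
    assume "before \<rho> 1 y"
    then show False using evD(2)[OF om _ yx] xy \<open>x \<noteq> 1\<close> by auto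
  qed
qed

text \<open>The preimage undoes the move of \<open>gamma\<close>: the entry \<open>a\<close> leaves
  the first block and becomes the first entry of the last one, giving a sandwiched permutation with
  parameters \<open>a - 1\<close> and \<open>b + 1\<close>. Since \<open>b = 0\<close> is allowed,
  this also covers lists whose last block is empty.\<close>

lemma psi_Q_surj_sandwich:
  assumes "evil_avoiding ([1..<a + 1] @ s @ [a + 1..<a + b + 1])" "1 \<le> a" "s \<noteq> []"
  shows "\<exists>\<sigma>. dom_op Q \<sigma> \<and> psi_q \<sigma> = (a + b + 1) # [1..<a + 1] @ map Suc s @ [a + 1..<a + b + 1]"
proof -
  obtain c where a: "a = Suc c" using assms(2) by (cases a) auto
  have p: "is_perm ([1..<a + 1] @ s @ [a + 1..<a + b + 1])"
    and e: "evil_free ([1..<a + 1] @ s @ [a + 1..<a + b + 1])"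
    using assms(1) by (auto simp: evil_avoiding_iff)
  define \<sigma> where "\<sigma> = [1..<c + 1] @ s @ [c + 1..<c + Suc b + 1]"
  have up: "[1..<a + 1] = [1..<c + 1] @ [c + 1]" "[c + 1..<c + Suc b + 1] = (c + 1) # [a + 1..<a + b + 1]"
    using upt_Suc_append[of 1 "c + 1"] upt_conv_Cons[of "c + 1" "c + Suc b + 1"] by (auto simp: a)
  have ps: "is_perm \<sigma>" using p is_perm_move[of "[1..<c + 1]" "c + 1" s "[a + 1..<a + b + 1]"]
    unfolding \<sigma>_def up by simp
  have "evil_free s" "distinct s" using evil_free_appendD[OF e] p by (auto simp: is_perm_def)
  then have "evil_free \<sigma>" unfolding \<sigma>_def using sandwich_gt[OF p]
    by (intro evil_free_sandwich) (auto simp: a)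
  moreover have "\<sigma> \<noteq> ident (length \<sigma>)"
    using min_recoil_sandwiched(2)[OF ps \<sigma>_def _ assms(3)] by (intro not_ident_if_before) auto
  moreover have "psi_q \<sigma> = (a + b + 1) # [1..<a + 1] @ map Suc s @ [a + 1..<a + b + 1]"
    using psi_q_sandwiched[OF ps \<sigma>_def _ assms(3)] by (simp add: a)
  ultimately show ?thesis using ps by (intro exI[of _ \<sigma>]) (simp add: evil_avoiding_iff)
qed

lemma psi_Q_surj:
  assumes ev: "evil_avoiding (h # \<rho>)" and h: "h \<noteq> 1" and ends: "\<And>k. 1 \<le> k \<Longrightarrow> \<not> ends k (h # \<rho>)"
  shows "\<exists>\<sigma>. dom_op Q \<sigma> \<and> psi_q \<sigma> = h # \<rho>"
proof -
  have p: "is_perm (h # \<rho>)" and e: "evil_free (h # \<rho>)" using ev by (auto simp: evil_avoiding_iff)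
  have d: "distinct \<rho>" and hn: "h \<notin> set \<rho>" using p by (auto simp: is_perm_def)
  have st: "set (h # \<rho>) = {1..length (h # \<rho>)}" using p by (simp only: is_perm_def)
  have hm: "h \<in> {1..length (h # \<rho>)}" unfolding st[symmetric] by simp
  then obtain t where t: "h = t + 1" "1 \<le> t" using h by (cases h) auto
  note inc = below_head_increasing[OF ev h ends]
  have tm: "i \<in> set \<rho>" if "1 \<le> i" "i \<le> t" for i
  proof -
    have "i \<in> set (h # \<rho>)" unfolding st using that hm t by auto
    then show ?thesis using that t by simp
  qed
  obtain \<sigma>0 where \<sigma>0: "\<rho> = map (shift h) \<sigma>0" "evil_avoiding \<sigma>0"
    using evil_avoiding_delete[of "[]" h \<rho>] ev by auto
  have p0: "is_perm \<sigma>0" using \<sigma>0 by (simp add: evil_avoiding_iff)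
  \<comment> \<open>If \<open>h\<close> were the maximum, \<rho> would consist of 1, ..., t in
    increasing order and be a final run.\<close>
  have tm2: "t + 2 \<in> set \<rho>"
  proof (rule ccontr)
    assume n: "t + 2 \<notin> set \<rho>"
    have "t + 2 \<notin> set (h # \<rho>)" using n t by simp
    then have "length (h # \<rho>) \<le> h" unfolding st using t by auto
    then have len: "length (h # \<rho>) = h" using hm by simp
    have "\<rho> = [1..<t + 1]"
    proof (rule eq_upt_if_before)
      show s: "set \<rho> = {1..<t + 1}"
      proof -
        have "set \<rho> = set (h # \<rho>) - {h}" using hn by simp
        also have "\<dots> = {1..h} - {h}" unfolding st len ..
        also have "\<dots> = {1..<t + 1}" using t by auto
        finally show ?thesis .
      qed
      fix a b assume ab: "before \<rho> a b"
      have "a \<in> {1..<t + 1}" "b \<in> {1..<t + 1}" using before_set[OF ab] s by auto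
      then show "a < b" using inc[of b a] before_asym[OF d ab] before_irrefl[OF d ab] t
        by (metis atLeastLessThan_iff linorder_neqE_nat)
    qed
    then have "h # \<rho> = [h] @ [1..<t + 1]" by simp
    then have "ends t (h # \<rho>)" unfolding ends_def by blast
    then show False using ends t by blast
  qed
  show ?thesis
  \<comment> \<open>If \<open>t + 2\<close> precedes \<open>t\<close>, deleting the head gives
    \<sigma>0 with smallest recoil \<open>t\<close>, which is the preimage unless it is sandwiched.
    Otherwise \<rho> turns out to start with 1, ..., t.\<close>
  proof (cases "before \<rho> (t + 2) t")
    case True
    have r: "before \<sigma>0 (t + 1) t"
      using True before_map_inj[OF inj_shift, of h \<sigma>0 "t + 1" t] by (simp add: shift_def \<sigma>0(1) t)
    have inc0: "before \<sigma>0 i (i + 1)" if "1 \<le> i" "i < t" for i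
      using inc[of i "i + 1"] that before_map_inj[OF inj_shift, of h \<sigma>0 i "i + 1"]
      by (simp add: shift_def \<sigma>0(1) t)
    have "t < length \<sigma>0" using before_set[OF r] p0 by (auto simp: is_perm_def)
    then have mr: "min_recoil \<sigma>0 = t"
      using p0 r inc0 t by (intro min_recoil_eqI) (auto simp: is_perm_def)
    have dom: "dom_op Q \<sigma>0" using \<sigma>0(2) not_ident_if_before[OF r] by simp
    then show ?thesis
    proof (cases rule: psi_q_cases)
      case (plain t')
      then show ?thesis using dom mr t \<sigma>0(1) by auto
    next
      case (sandwiched a b s)
      have tab: "t = a + b" using min_recoil_sandwiched(1)[OF p0 sandwiched(1-3)] mr by simp
      have \<rho>: "\<rho> = [1..<a + 1] @ map Suc s @ [a + 1..<a + b + 1]"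
        unfolding \<sigma>0(1) sandwiched(1) t tab by (rule map_shift_sandwich) (use sandwiched(5) in blast)
      \<comment> \<open>With \<open>a = 0\<close> the whole run 1, ..., t would stand at the
        end.\<close>
      have "a \<noteq> 0"
      proof
        assume "a = 0"
        then have "h # \<rho> = (h # map Suc s) @ [1..<t + 1]" using \<rho> tab by simp
        then have "ends t (h # \<rho>)" unfolding ends_def by blast
        then show False using ends t by blast
      qed
      then show ?thesis
        using psi_Q_surj_sandwich[of a s b] \<sigma>0(2) sandwiched(1,3) \<rho> t tab by simp
    qed
  next
    case False
    then have b: "before \<rho> t (t + 2)" using before_total[OF tm2 tm[of t]] t by auto
    obtain xs ys where xy: "\<rho> = xs @ t # ys" using tm[of t] t split_list by fastforce
    have bt: "before \<rho> z t \<longleftrightarrow> z \<in> set xs" for z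
      using d before_set[of xs z t] before_set[of ys z t] unfolding xy by (auto simp: before_append)
    have "xs = [1..<t]"
    proof (rule eq_upt_if_before)
      have lt: "z \<in> {1..<t}" if "z \<in> set xs" for z
      proof -
        have zt: "before \<rho> z t" using that bt by blast
        have zm: "z \<in> set \<rho>" using before_set[OF zt] by simp
        have "z \<noteq> t + 2" using zt False by metis
        \<comment> \<open>Otherwise \<open>h\<close>, \<open>z\<close>, \<open>t\<close>,
          \<open>t + 2\<close> is a 2413.\<close>
        moreover have "\<not> t + 2 < z"
          using evil_freeD(1)[OF e, of h z t "t + 2"] zm zt b t by auto
        moreover have "z \<noteq> t + 1" using zm hn t by auto
        moreover have "z \<noteq> t" using before_irrefl[OF d zt] .
        moreover have "1 \<le> z" using is_perm_pos[OF p] zm by simp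
        ultimately show ?thesis by auto
      qed
      moreover have "z \<in> set xs" if "z \<in> {1..<t}" for z
        using bt inc[of z t] that t by simp
      ultimately show "set xs = {1..<t}" by blast
      fix a b assume ab: "before xs a b"
      then have ab': "before \<rho> a b" unfolding xy by (simp add: before_append)
      have "a \<in> {1..<t}" "b \<in> {1..<t}" using before_set[OF ab] lt by auto
      then show "a < b" using inc[of b a] before_asym[OF d ab'] before_irrefl[OF d ab'] t
        by (cases "a < b") auto
    qed
    then have \<rho>: "\<rho> = [1..<t + 1] @ ys" using xy upt_Suc_append[of 1 t] t by simp
    then obtain v s where vs: "\<sigma>0 = v @ s" "map (shift h) v = [1..<t + 1]" "map (shift h) s = ys"
      using \<sigma>0(1) by (auto simp: map_eq_append_conv)
    have "map (shift h) [1..<t + 1] = [1..<t + 1]"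
      using t by (intro map_shift_below) auto
    then have "v = [1..<t + 1]" using vs(2) map_shift_eq_iff by metis
    \<comment> \<open>This is the sandwich shape with \<open>a = t\<close> and an empty last block,
      written with \<open>b = 0\<close>.\<close>
    then have s0: "\<sigma>0 = [1..<t + 1] @ s @ [t + 1..<t + 0 + 1]" using vs by simp
    have "ys = map Suc s" using vs(3) sandwich_gt[OF p0[unfolded s0]] t
      by (intro trans[OF vs(3)[symmetric]] map_shift_above) fastforce
    moreover have "s \<noteq> []"
    proof
      assume "s = []"
      then have "\<rho> = [1..<t + 1]" using \<rho> calculation by simp
      then show False using tm2 by simp
    qed
    ultimately show ?thesis
      using psi_Q_surj_sandwich[OF \<sigma>0(2)[unfolded s0] t(2)] \<rho> t by simp
  qed
qed

section \<open>The last operator\<close>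

text \<open>The list \<open>[1]\<close> is listed separately: it ends with 1, but it arises from the
  empty permutation by \<open>S\<close>, where \<open>R\<close> is not defined. Otherwise
  \<open>S\<close> extends an existing run and so leaves one of length at least 2.\<close>

definition last_op :: "nat list \<Rightarrow> op" where
  "last_op \<tau> = (if \<tau> = [1] \<or> (\<exists>k\<ge>2. ends k \<tau>) then S else if ends 1 \<tau> then R
     else if hd \<tau> = 1 then P else Q)"

lemma last_ends: "ends k \<tau> \<Longrightarrow> 1 \<le> k \<Longrightarrow> last \<tau> = k"
  by (auto simp: ends_def)

text \<open>Collects what the induction needs: the class is preserved, each step adds one entry, and
  the operator is visible in its result, so that the images of the four operators are
  disjoint.\<close>

lemma evil_avoiding_psi:
  assumes "dom_op x \<sigma>"
  shows "evil_avoiding (psi x \<sigma>) \<and> length (psi x \<sigma>) = Suc (length \<sigma>) \<and> last_op (psi x \<sigma>) = x"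
proof (cases x)
  case P
  have p: "is_perm \<sigma>" and e: "evil_free \<sigma>" and n: "\<sigma> \<noteq> ident (length \<sigma>)"
    using assms P by (auto simp: evil_avoiding_iff)
  have \<tau>: "psi x \<sigma> = 1 # map (shift 1) \<sigma>" unfolding P psi.simps rho_front ..
  have pp: "is_perm (1 # map (shift 1) \<sigma>)" using p by (subst is_perm_Cons_shift) auto
  have "evil_free ([1] @ map (shift 1) \<sigma>)"
  proof (rule evil_free_prepend_smaller)
    show "evil_free (map (shift 1) \<sigma>)" using e by (simp add: evil_free_map strict_mono_shift)
    show "distinct ([1] @ map (shift 1) \<sigma>)" using pp by (simp add: is_perm_def)
    show "i < j" if "i \<in> set [1]" "j \<in> set (map (shift 1) \<sigma>)" for i j
      using that is_perm_pos[OF p] by (auto simp: shift_def Suc_le_eq split: if_splits)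
  qed simp
  moreover have "\<not> ends k (psi x \<sigma>)" if "1 \<le> k" for k
  proof
    assume "ends k (psi x \<sigma>)"
    then obtain us where us: "1 # map (shift 1) \<sigma> = us @ [1..<k + 1]" using \<tau> by (auto simp: ends_def)
    \<comment> \<open>The entry 1 occurs only in front, so a final run 1, ..., k is the whole list,
      and the argument is an identity.\<close>
    have "us = []" using pp that unfolding us by (cases us) (use us in \<open>auto simp: is_perm_def\<close>)
    then have "map (shift 1) \<sigma> = [2..<k + 1]"
      using us upt_conv_Cons[of 1 "k + 1"] that by (simp add: numeral_2_eq_2)
    also have "map (shift 1) \<sigma> = map Suc \<sigma>" using is_perm_pos[OF p] by (intro map_shift_above)
    also have "[2..<k + 1] = map Suc [1..<k]" by (simp add: map_Suc_upt numeral_2_eq_2)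
    finally have "\<sigma> = [1..<k]" by (metis inj_map_eq_map inj_Suc)
    then have "\<sigma> = ident (length \<sigma>)" using that by (simp add: ident_def)
    then show False using n by simp
  qed
  \<comment> \<open>This excludes the result \<open>[1]\<close>, which \<open>last_op\<close>
    assigns to \<open>S\<close>.\<close>
  moreover have "\<sigma> \<noteq> []" using n by (auto simp: ident_def)
  ultimately show ?thesis using pp unfolding \<tau> evil_avoiding_iff last_op_def
    by (auto simp: P)
next
  case Q
  then have dom: "dom_op Q \<sigma>" using assms by simp
  have "length (psi_q \<sigma>) = Suc (length \<sigma>)"
    using dom by (cases rule: psi_q_cases) auto
  moreover have "psi_q \<sigma> \<noteq> [1]" using hd_psi_Q[OF dom] by auto
  ultimately show ?thesis
    using evil_avoiding_psi_Q[OF dom] hd_psi_Q[OF dom] not_ends_psi_Q[OF dom] Q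
    by (auto simp: last_op_def)
next
  case R
  have p: "is_perm \<sigma>" and e: "evil_free \<sigma>" and n: "\<sigma> \<noteq> []"
    using assms R by (auto simp: evil_avoiding_iff)
  have \<tau>: "psi x \<sigma> = map (shift 1) \<sigma> @ [1]" unfolding R psi.simps rho_back ..
  have pp: "is_perm (map (shift 1) \<sigma> @ [1])" using p is_perm_insert[of 1 \<sigma> "[]"] by simp
  have "evil_free (map (shift 1) \<sigma> @ [1])"
  proof (rule evil_free_append_smaller)
    show "evil_free (map (shift 1) \<sigma>)" using e by (simp add: evil_free_map strict_mono_shift)
    show "distinct (map (shift 1) \<sigma> @ [1])" using pp by (simp add: is_perm_def)
    show "j < i" if "i \<in> set (map (shift 1) \<sigma>)" "j \<in> set [1]" for i j
      using that is_perm_pos[OF p] by (auto simp: shift_def Suc_le_eq split: if_splits)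
  qed simp
  moreover have "ends 1 (psi x \<sigma>)" unfolding \<tau> ends_def by (intro exI[of _ "map (shift 1) \<sigma>"]) (simp add: upt_Suc)
  moreover have "\<not> ends k (psi x \<sigma>)" if "2 \<le> k" for k
    using last_ends[of k "psi x \<sigma>"] that by (auto simp: \<tau>)
  ultimately show ?thesis using pp n unfolding \<tau> evil_avoiding_iff last_op_def
    by (auto simp: R)
next
  case S
  have ev: "evil_avoiding \<sigma>" and "\<sigma> = [] \<or> (\<exists>k\<ge>1. ends k \<sigma>)"
    using assms unfolding S dom_op_S_iff by auto
  then show ?thesis
  proof (elim disjE)
    assume "\<sigma> = []"
    then show ?thesis using S by (auto simp: evil_avoiding_iff is_perm_def evil_free_def last_op_def)
  next
    assume "\<exists>k\<ge>1. ends k \<sigma>"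
    then obtain k us where k: "1 \<le> k" "\<sigma> = us @ [1..<k + 1]" by (auto simp: ends_def)
    have p: "is_perm (us @ [1..<k + 1])" and e: "evil_free (us @ [1..<k + 1])"
      using ev k by (auto simp: evil_avoiding_iff)
    note ps = psi_S_ends[OF p k(1)]
    have \<tau>: "psi x \<sigma> = map Suc us @ [1..<k + 2]" using ps(1) k(2) S by simp
    have pp: "is_perm (psi x \<sigma>)"
      using p is_perm_insert[of "k + 1" \<sigma> "[]"] unfolding S k(2) ps(2) by simp
    have "evil_free (map Suc us @ [1..<k + 2])"
    proof (rule evil_free_append_smaller)
      show "evil_free (map Suc us)"
        using evil_free_appendD[of "[]" us] e by (simp add: evil_free_map strict_mono_Suc_iff)
      show "distinct (map Suc us @ [1..<k + 2])" using pp by (simp only: is_perm_def \<tau>)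
      show "j < i" if "i \<in> set (map Suc us)" "j \<in> set [1..<k + 2]" for i j
        using that ps(3) by fastforce
    qed simp
    moreover have "ends (k + 1) (psi x \<sigma>)" unfolding \<tau> ends_def by (intro exI[of _ "map Suc us"]) simp
    then have "last_op (psi x \<sigma>) = S" using k(1) by (auto simp: last_op_def intro!: exI[of _ "k + 1"])
    ultimately show ?thesis using pp k(2) unfolding \<tau> evil_avoiding_iff by (simp add: S)
  qed
qed

text \<open>For \<open>P\<close> and \<open>R\<close> the inserted entry is deleted at a known end.
  For \<open>S\<close> the lengths settle the empty argument; otherwise the last entry
  \<open>k + 1\<close> gives the length of the run, which can be split off.\<close>

lemma psi_inj:
  assumes "dom_op x \<sigma>" "dom_op x \<sigma>'" "psi x \<sigma> = psi x \<sigma>'"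
  shows "\<sigma> = \<sigma>'"
proof (cases x)
  case P
  then show ?thesis using assms(3) unfolding P psi.simps rho_front by (simp add: map_shift_eq_iff)
next
  case Q
  then show ?thesis using assms psi_Q_inj by simp
next
  case R
  then show ?thesis using assms(3) unfolding R psi.simps rho_back by (simp add: map_shift_eq_iff)
next
  case S
  have len: "length \<sigma> = length \<sigma>'" using assms evil_avoiding_psi by (metis nat.inject)
  have *: "\<sigma> = [] \<or> (\<exists>k\<ge>1. ends k \<sigma>)" "\<sigma>' = [] \<or> (\<exists>k\<ge>1. ends k \<sigma>')"
    using assms unfolding S dom_op_S_iff by auto
  show ?thesis
  proof (cases "\<sigma> = []")
    case False
    then obtain k us k' us' where k: "1 \<le> k" "\<sigma> = us @ [1..<k + 1]" "1 \<le> k'" "\<sigma>' = us' @ [1..<k' + 1]"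
      using * len unfolding ends_def by fastforce
    have p: "is_perm (us @ [1..<k + 1])" "is_perm (us' @ [1..<k' + 1])"
      using assms k unfolding S dom_op_S_iff evil_avoiding_iff by auto
    have eq: "map Suc us @ [1..<k + 2] = map Suc us' @ [1..<k' + 2]"
      using assms(3) psi_S_ends(1)[OF p(1) k(1)] psi_S_ends(1)[OF p(2) k(3)] k S by simp
    have "k = k'" using arg_cong[OF eq, of last] by simp
    then show ?thesis using eq k by (simp add: inj_map_eq_map)
  qed (use len in simp)
qed

text \<open>For \<open>S\<close>, deleting the last entry \<open>k\<close> leaves the smaller values
  untouched, so a run 1, ..., k - 1 remains. For \<open>R\<close> and \<open>P\<close> the entry 1
  is deleted; for \<open>P\<close> the remainder is not an identity, since otherwise \<tau> would
  itself be a final run. The rest is \<open>psi_Q_surj\<close>.\<close>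

lemma psi_surj:
  assumes ev: "evil_avoiding \<tau>" and ne: "\<tau> \<noteq> []"
  shows "\<exists>\<sigma>. dom_op (last_op \<tau>) \<sigma> \<and> psi (last_op \<tau>) \<sigma> = \<tau>"
proof -
  consider "\<tau> = [1]" | k where "2 \<le> k" "ends k \<tau>" | "\<tau> \<noteq> [1]" "\<not> (\<exists>k\<ge>2. ends k \<tau>)" by blast
  then show ?thesis
  proof cases
    case 1
    have "evil_avoiding []" by (simp add: evil_avoiding_iff is_perm_def evil_free_def)
    then show ?thesis using 1 by (intro exI[of _ "[]"]) (simp add: last_op_def ident_def)
  next
    case 2
    then have op: "last_op \<tau> = S" by (auto simp: last_op_def)
    obtain us where us: "\<tau> = us @ [1..<k + 1]" using 2 by (auto simp: ends_def)
    then have \<tau>: "\<tau> = (us @ [1..<k]) @ k # []" using upt_Suc_append[of 1 k] 2 by simp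
    then obtain \<sigma> where \<sigma>: "us @ [1..<k] = map (shift k) \<sigma>" "evil_avoiding \<sigma>"
      using evil_avoiding_delete[of "us @ [1..<k]" k "[]"] ev by auto
    then obtain u v where uv: "\<sigma> = u @ v" "map (shift k) v = [1..<k]"
      by (metis map_eq_append_conv)
    have "map (shift k) [1..<k] = [1..<k]" by (intro map_shift_below) auto
    then have "v = [1..<k]" using uv(2) map_shift_eq_iff by metis
    then have s: "\<sigma> = u @ [1..<(k - 1) + 1]" using uv(1) 2 by simp
    have "is_perm (u @ [1..<(k - 1) + 1])" using \<sigma>(2) s by (simp add: evil_avoiding_iff)
    then have "psi S \<sigma> = map (shift k) \<sigma> @ [k]"
      using psi_S_ends(2)[of u "k - 1"] 2 unfolding s by simp
    then have "psi S \<sigma> = \<tau>" using \<tau> \<sigma>(1) by simp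
    moreover have "ends (k - 1) \<sigma>" unfolding ends_def using s by blast
    then have "dom_op S \<sigma>" unfolding dom_op_S_iff using \<sigma>(2) 2
      by (intro conjI disjI2 exI[of _ "k - 1"]) simp_all
    ultimately show ?thesis unfolding op by blast
  next
    case 3
    show ?thesis
    proof (cases "ends 1 \<tau>")
      case True
      then have op: "last_op \<tau> = R" using 3 by (auto simp: last_op_def)
      obtain us where us: "\<tau> = us @ 1 # []" using True by (auto simp: ends_def upt_Suc)
      then obtain \<sigma> where \<sigma>: "us = map (shift 1) \<sigma>" "evil_avoiding \<sigma>"
        using evil_avoiding_delete[of us 1 "[]"] ev by auto
      have "\<sigma> \<noteq> []" using 3 us \<sigma> by auto
      then have "dom_op R \<sigma>" using \<sigma> by (simp add: Suc_le_eq)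
      moreover have "psi R \<sigma> = \<tau>" unfolding psi.simps rho_back using \<sigma> us by simp
      ultimately show ?thesis unfolding op by blast
    next
      case False
      obtain h \<rho> where \<tau>: "\<tau> = h # \<rho>" using ne by (cases \<tau>) auto
      have ends: "\<not> ends k \<tau>" if "1 \<le> k" for k
      proof (cases "k = 1")
        case True
        then show ?thesis using False by simp
      next
        case False
        then have "2 \<le> k" using that by simp
        then show ?thesis using 3 by blast
      qed
      show ?thesis
      proof (cases "h = 1")
        case True
        then have op: "last_op \<tau> = P" using 3 False \<tau> by (auto simp: last_op_def)
        obtain \<sigma> where \<sigma>: "\<rho> = map (shift 1) \<sigma>" "evil_avoiding \<sigma>"
          using evil_avoiding_delete[of "[]" 1 \<rho>] ev \<tau> True by auto
        have "\<sigma> \<noteq> ident (length \<sigma>)"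
        proof
          assume i: "\<sigma> = ident (length \<sigma>)"
          have "map (shift 1) \<sigma> = map Suc \<sigma>"
            using is_perm_pos \<sigma>(2) by (intro map_shift_above) (auto simp: evil_avoiding_iff)
          also have "\<dots> = map Suc [1..<length \<sigma> + 1]" using i unfolding ident_def by metis
          also have "\<dots> = [2..<length \<sigma> + 2]" by (simp add: map_Suc_upt numeral_2_eq_2)
          finally have "\<tau> = [1..<(length \<sigma> + 1) + 1]"
            using \<tau> True \<sigma>(1) upt_conv_Cons[of 1 "length \<sigma> + 2"] by (simp add: numeral_2_eq_2)
          then have "ends (length \<sigma> + 1) \<tau>" unfolding ends_def by simp
          then show False using ends by simp
        qed
        then have "dom_op P \<sigma>" using \<sigma> by simp
        moreover have "psi P \<sigma> = \<tau>" unfolding psi.simps rho_front using \<sigma> \<tau> True by simp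
        ultimately show ?thesis unfolding op by blast
      next
        case h: False
        then have "last_op \<tau> = Q" using 3 False \<tau> by (auto simp: last_op_def)
        then show ?thesis using psi_Q_surj[of h \<rho>] ev h ends \<tau> by simp
      qed
    qed
  qed
qed

section \<open>Words of operators and unique factorization\<close>

lemma run_snoc:
  "run (xs @ [x]) \<sigma> = Some \<pi> \<longleftrightarrow> (\<exists>\<tau>. run xs \<sigma> = Some \<tau> \<and> dom_op x \<tau> \<and> psi x \<tau> = \<pi>)"
  by (induction xs arbitrary: \<sigma>) auto

text \<open>Each operator adds one entry. In particular, only the empty word produces the empty
  permutation.\<close>

lemma length_run: "run xs \<sigma> = Some \<pi> \<Longrightarrow> length \<pi> = length \<sigma> + length xs"
proof (induction xs arbitrary: \<sigma>)
  case (Cons x xs)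
  then have "dom_op x \<sigma>" "run xs (psi x \<sigma>) = Some \<pi>"
    unfolding run.simps by (metis option.distinct(1))+
  then show ?case using Cons.IH evil_avoiding_psi[of x \<sigma>] by simp
qed simp

text \<open>Induction on the length: \<open>psi_surj\<close> provides a last step,
  \<open>last_op\<close> forces its operator and \<open>psi_inj\<close> its argument, and the
  induction hypothesis gives the unique word for that argument.\<close>

theorem theorem5p15:
  assumes "evil_avoiding \<pi>"
  shows "\<exists>!xs. run xs [] = Some \<pi>"
  using assms
proof (induction "length \<pi>" arbitrary: \<pi>)
  case 0
  then have "\<pi> = []" by simp
  moreover have "xs = []" if "run xs [] = Some []" for xs
    using length_run[OF that] by simp
  ultimately show ?case by (intro ex1I[of _ "[]"]) simp_all
next
  case (Suc n)
  then have ne: "\<pi> \<noteq> []" by auto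
  obtain \<sigma> where \<sigma>: "dom_op (last_op \<pi>) \<sigma>" "psi (last_op \<pi>) \<sigma> = \<pi>"
    using psi_surj[OF Suc.prems ne] by blast
  have "evil_avoiding \<sigma>" using \<sigma>(1) by (cases "last_op \<pi>") auto
  moreover have "n = length \<sigma>" using evil_avoiding_psi[OF \<sigma>(1)] \<sigma>(2) Suc.hyps(2) by simp
  ultimately obtain ys where ys: "run ys [] = Some \<sigma>" "\<And>zs. run zs [] = Some \<sigma> \<Longrightarrow> zs = ys"
    using Suc.hyps(1) by blast
  show ?case
  proof (rule ex1I)
    show "run (ys @ [last_op \<pi>]) [] = Some \<pi>" unfolding run_snoc using ys \<sigma> by blast
    fix xs assume xs: "run xs [] = Some \<pi>"
    have "xs \<noteq> []" using xs ne by auto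
    then obtain zs x where zx: "xs = zs @ [x]" by (metis rev_exhaust)
    then obtain \<sigma>' where \<sigma>': "run zs [] = Some \<sigma>'" "dom_op x \<sigma>'" "psi x \<sigma>' = \<pi>"
      using xs run_snoc by metis
    have x: "x = last_op \<pi>" using evil_avoiding_psi[OF \<sigma>'(2)] \<sigma>'(3) by simp
    then have "\<sigma>' = \<sigma>" using psi_inj \<sigma> \<sigma>' by metis
    then show "xs = ys @ [last_op \<pi>]" using zx x ys(2) \<sigma>'(1) by simp
  qed
qed

end
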